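(* Assume $q\neq0$, $b_5\neq q^{-1/2}$, $t\neq0$, $g\neq0,\,b_6t,\,b_6^{-1}t$ and $a_n\neq0$. Then the variables $f,g$ satisfy the first-order $q$-difference equation $$(g\check f-1)(gf-1)=t^2\,\frac{(g-b_1^{-1})(g-b_2^{-1})(g-b_3^{-1})(g-b_4^{-1})}{(g-b_6t)(g-b_6^{-1}t)},$$ where $f=f(t)$, $g=g(t)$, $\check f=f(q^{-1}t)$.
   Context: Fix $q$ with $0<|q|<1$, $(a;q)_\infty=\prod_{j\ge0}(1-aq^j)$, $(a_1,\dots,a_m;q)_\infty=\prod_i(a_i;q)_\infty$. Let $b_1,b_2,b_3,b_4,b_6$ be nonzero complex parameters with $b_1b_2b_3b_4=1$, and let $t\ne0$ be the deformation variable. A hat denotes $t\mapsto qt$, a check denotes $t\mapsto q^{-1}t$; hypotheses such as $g\ne0$ are understood at every point of the lattice $tq^{\mathbb Z}$ that is involved. The weight is $$w(x;t)=\frac{(b_2x,b_3x,b_6^{-1}xt^{-1};q)_\infty}{(b_1x,b_4x,b_6xt^{-1};q)_\infty}.$$ Put $$D_+(x;t)=b_6(1-b_1x)(1-b_4x)(t-b_6x),\qquad D_-(x;t)=(1-b_2x)(1-b_3x)(b_6t-x),$$ $$E_+(x;t)=b_6^{-1}(b_6qt-x),\qquad E_-(x;t)=qt-b_6x,$$ so that $w(qx;t)/w(x;t)=D_+/D_-$ and $w(x;qt)/w(x;t)=E_+/E_-$. Orthogonality is with respect to a Thomae–Jackson $q$-integral $\int_G$ in $x$ whose terminals coincide with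 zeros/poles of the weight, so that boundary terms vanish. Concretely, the Stieltjes function $\phi(x;t)=\int_G \frac{w(y;t)}{x-y}$ satisfies $D_-(x;t)\phi(qx;t)=D_+(x;t)\phi(x;t)+(q-1)x\,U(x;t)$ and $E_-(x;t)\phi(x;qt)=E_+(x;t)\phi(x;t)+(q-1)t\,T(x;t)$ with $U,T$ polynomial in $x$. The orthonormal polynomials $p_n(x;t)=\gamma_nx^n+\cdots$ ($\int_G w\,p_np_m=\delta_{nm}$, $\gamma_n=\gamma_n(t)\ne0$) are assumed to exist for all $n\ge0$; $a_n=\gamma_{n-1}/\gamma_n$ for $n\ge1$ is the off-diagonal coefficient of the three-term recurrence, and $a_0$ is an arbitrary nonzero quantity. Functions of the second kind: $q_n(x;t)=\int_G \frac{w(y;t)p_n(y;t)}{x-y}$ for $n\ge0$, with $p_{-1}=0$, $q_{-1}=1/(a_0\gamma_0)$. Set $$Y_n(x;t)=\begin{pmatrix}p_n & q_n/w\\ p_{n-1}& q_{n-1}/w\end{pmatrix}.$$ The spectral matrix $A_n^*$ is the matrix, polynomial in $x$, defined by $D_+(x;t)\,Y_n(qx;t)=A_n^*(x;t)\,Y_n(x;t)$, with entries written $$A_n^*=\begin{pmatrix}\mathfrak W_+&-\mathfrak T_+\\ \mathfrak T_-&\mathfrak W_-\end{pmatrix}.$$ Fix $n\in\mathbb Z_{\ge0}$ and put $b_5=b_1b_4b_6q^n$. Then $\mathfrak T_+$ is $x$ times a polynomial of degree one in $x$; $g(t)$ (also written $\lambda_n(t)$) denotes the zero of that degree-one polynomial.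 The variable $f$ is defined by $$\mathfrak W_+(g(t);t)=-\frac1t\,(g(t)-b_6t)(b_6g(t)-t)\,\big(f(q^{-1}t)\,g(t)-1\big).$$ *)

theory Defs
  imports "HOL-Analysis.Analysis" "HOL-Computational_Algebra.Polynomial"
begin

definition qpoch :: "complex \<Rightarrow> complex \<Rightarrow> complex" where
  "qpoch a q = (\<Prod>j. 1 - a * q ^ j)"

definition weight_num ::
  "complex \<Rightarrow> complex \<Rightarrow> complex \<Rightarrow> complex \<Rightarrow> complex \<Rightarrow> complex \<Rightarrow> complex" where
  "weight_num q b2 b3 b6 t x = qpoch (b2 * x) q * qpoch (b3 * x) q * qpoch (x / (b6 * t)) q"

definition weight_den ::
  "complex \<Rightarrow> complex \<Rightarrow> complex \<Rightarrow> complex \<Rightarrow> complex \<Rightarrow> complex \<Rightarrow> complex" where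
  "weight_den q b1 b4 b6 t x = qpoch (b1 * x) q * qpoch (b4 * x) q * qpoch (b6 * x / t) q"

definition weight ::
  "complex \<Rightarrow> complex \<Rightarrow> complex \<Rightarrow> complex \<Rightarrow> complex \<Rightarrow> complex \<Rightarrow> complex \<Rightarrow> complex \<Rightarrow> complex" where
  "weight q b1 b2 b3 b4 b6 t x = weight_num q b2 b3 b6 t x / weight_den q b1 b4 b6 t x"

definition D_plus ::
  "complex \<Rightarrow> complex \<Rightarrow> complex \<Rightarrow> complex \<Rightarrow> complex \<Rightarrow> complex" where
  "D_plus b1 b4 b6 t x = b6 * (1 - b1 * x) * (1 - b4 * x) * (t - b6 * x)"

definition D_minus ::
  "complex \<Rightarrow> complex \<Rightarrow> complex \<Rightarrow> complex \<Rightarrow> complex \<Rightarrow> complex" where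
  "D_minus b2 b3 b6 t x = (1 - b2 * x) * (1 - b3 * x) * (b6 * t - x)"

definition E_plus :: "complex \<Rightarrow> complex \<Rightarrow> complex \<Rightarrow> complex \<Rightarrow> complex" where
  "E_plus q b6 t x = (b6 * q * t - x) / b6"

definition E_minus :: "complex \<Rightarrow> complex \<Rightarrow> complex \<Rightarrow> complex \<Rightarrow> complex" where
  "E_minus q b6 t x = q * t - b6 * x"

text \<open>The Thomae--Jackson integrals from \<open>0\<close> to \<open>a\<close> and from \<open>a\<close> to \<open>b\<close>.
  By \<open>x / 0 = 0\<close>, a sample point at a pole of the weight would contribute \<open>0\<close>.\<close>

definition jackson0 :: "complex \<Rightarrow> complex \<Rightarrow> (complex \<Rightarrow> complex) \<Rightarrow> complex" where
  "jackson0 q a F = (1 - q) * a * (\<Sum>k. q ^ k * F (a * q ^ k))"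

definition jackson :: "complex \<Rightarrow> complex \<Rightarrow> complex \<Rightarrow> (complex \<Rightarrow> complex) \<Rightarrow> complex" where
  "jackson q a b F = jackson0 q b F - jackson0 q a F"

text \<open>An integration domain is a finite chain of intervals: an entry \<open>(c, a, b)\<close> stands for
  \<open>c\<close> times the integral from \<open>a\<close> to \<open>b\<close>.  A single interval is \<open>[(1, a, b)]\<close>.\<close>

type_synonym chain = "(complex \<times> complex \<times> complex) list"

definition qint :: "complex \<Rightarrow> chain \<Rightarrow> (complex \<Rightarrow> complex) \<Rightarrow> complex" where
  "qint q G F = (\<Sum>(c, a, b)\<leftarrow>G. c * jackson q a b F)"

definition terminals :: "chain \<Rightarrow> complex set" where
  "terminals G = (\<Union>(c, a, b)\<in>set G. {a, b})"

text \<open>The sum in \<open>jackson0 q e\<close> starts at \<open>e\<close>, so its boundary term sits at \<open>e / q\<close>.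
  The zero set of \<open>\<lambda>x. qpoch (c * x) q\<close> is closed under \<open>x \<mapsto> x / q\<close>; hence the condition
  also holds whenever \<open>e\<close> itself is a zero of the numerator or of the denominator.\<close>

definition boundary_point ::
  "complex \<Rightarrow> complex \<Rightarrow> complex \<Rightarrow> complex \<Rightarrow> complex \<Rightarrow> complex \<Rightarrow> complex \<Rightarrow> complex \<Rightarrow> bool" where
  "boundary_point q b1 b2 b3 b4 b6 t e \<longleftrightarrow>
     weight_num q b2 b3 b6 t (e / q) = 0 \<or> weight_den q b1 b4 b6 t (e / q) = 0"

text \<open>The points sampled by \<open>qint q G\<close>, together with their accumulation point \<open>0\<close>;
  off this set the Stieltjes function and the functions of the second kind are analytic.\<close>

definition support :: "complex \<Rightarrow> chain \<Rightarrow> complex set" where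
  "support q G = {0} \<union> {a * q ^ k | a k. a \<in> terminals G}"

definition second_kind ::
  "complex \<Rightarrow> (complex \<Rightarrow> complex) \<Rightarrow> chain \<Rightarrow> complex poly \<Rightarrow> complex \<Rightarrow> complex" where
  "second_kind q w G P x = qint q G (\<lambda>y. w y * poly P y / (x - y))"

definition stieltjes ::
  "complex \<Rightarrow> (complex \<Rightarrow> complex) \<Rightarrow> chain \<Rightarrow> complex \<Rightarrow> complex" where
  "stieltjes q w G x = qint q G (\<lambda>y. w y / (x - y))"

definition orthonormal_polys ::
  "complex \<Rightarrow> (complex \<Rightarrow> complex) \<Rightarrow> chain \<Rightarrow> (nat \<Rightarrow> complex poly) \<Rightarrow> (nat \<Rightarrow> complex) \<Rightarrow> bool" where
  "orthonormal_polys q w G p \<gamma> \<longleftrightarrow>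
     (\<forall>n. degree (p n) = n \<and> lead_coeff (p n) = \<gamma> n \<and> \<gamma> n \<noteq> 0) \<and>
     (\<forall>n m. qint q G (\<lambda>y. w y * poly (p n) y * poly (p m) y) = (if n = m then 1 else 0))"

text \<open>The conventions \<open>p\<^sub>-\<^sub>1 = 0\<close> and \<open>q\<^sub>-\<^sub>1 = 1 / (a\<^sub>0 \<gamma>\<^sub>0)\<close> give the
  second row for \<open>n = 0\<close>.\<close>

definition Y_mat ::
  "complex \<Rightarrow> (complex \<Rightarrow> complex) \<Rightarrow> chain \<Rightarrow> (nat \<Rightarrow> complex poly) \<Rightarrow> (nat \<Rightarrow> complex) \<Rightarrow>
   complex \<Rightarrow> nat \<Rightarrow> complex \<Rightarrow> complex^2^2" where
  "Y_mat q w G p \<gamma> a0 n x = vector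
     [vector [poly (p n) x, second_kind q w G (p n) x / w x],
      vector [if n = 0 then 0 else poly (p (n - 1)) x,
              (if n = 0 then 1 / (a0 * \<gamma> 0) else second_kind q w G (p (n - 1)) x) / w x]]"

definition eval_mat :: "complex poly^2^2 \<Rightarrow> complex \<Rightarrow> complex^2^2" where
  "eval_mat M x = (\<chi> i j. poly (M $ i $ j) x)"

end

theory Submission
  imports Defs
begin

text \<open>
  Write \<open>t' = qt\<close> and let \<open>u, v\<close> be the functions of the second kind of index \<open>n, n - 1\<close>.
  The (1,2) entry \<open>- P\<close> of \<open>E\<^sub>+(x) Y(x;t') Y(x;t)\<^sup>-\<^sup>1\<close> is polynomial in \<open>x\<close> and bounded at infinity,
  hence constant.  Comparing (1,2) entries in the compatibility of the \<open>x\<close>- and \<open>t\<close>-shifts gives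
  \<open>R(qx) T\<^sub>+ + P W\<^sub>- = q (t - b\<^sub>6x)(b\<^sub>6t - x) l(x)\<close> at \<open>t\<close> and
  \<open>P W\<^sub>+ + T\<^sub>+ S = (t' - b\<^sub>6x)(b\<^sub>6t' - x) l(x)\<close> at \<open>t'\<close>, with the same function \<open>l\<close>.
  As the two quadratic factors need not be coprime, that \<open>l\<close> is a polynomial is seen analytically:
  \<open>b\<^sub>6t\<close> and \<open>t / b\<^sub>6\<close> carry no mass, so the Stieltjes functions are bounded there.  The growth at
  infinity gives \<open>degree l \<le> 1\<close>, and \<open>l(0) = P / t'\<close>.

  The second relation at \<open>x = g(t')\<close>, where \<open>T\<^sub>+\<close> vanishes, yields \<open>l(x) = (P / t') (1 - f(t) x)\<close>;
  the first one at \<open>x = g(t)\<close> then evaluates \<open>W\<^sub>-(g(t); t)\<close>, and the theorem is the determinant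
  identity \<open>W\<^sub>+ W\<^sub>- + T\<^sub>+ T\<^sub>- = D\<^sub>+ D\<^sub>-\<close> at \<open>g(t)\<close>.  If \<open>P\<close> were \<open>0\<close>, \<open>l\<close> would vanish
  at \<open>0\<close> and at \<open>g(t)\<close>, so \<open>R(qx) T\<^sub>+ = 0\<close>, against the leading coefficients of \<open>R\<close> and \<open>T\<^sub>+\<close>
  (the latter is where \<open>q b\<^sub>5\<^sup>2 \<noteq> 1\<close> enters).
\<close>

section \<open>The weight\<close>

lemma convergent_prod_qpoch:
  assumes "norm q < 1"
  shows "convergent_prod (\<lambda>j. 1 - a * q ^ j :: complex)"
proof -
  have "summable (\<lambda>j. norm a * norm q ^ j)"
    using assms by (intro summable_mult summable_geometric) simp
  then have "abs_convergent_prod (\<lambda>j. 1 - a * q ^ j)"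
    by (simp add: abs_convergent_prod_conv_summable norm_mult norm_power)
  then show ?thesis
    by (rule abs_convergent_prod_imp_convergent_prod)
qed

lemma qpoch_step:
  assumes "norm q < 1"
  shows "qpoch a q = (1 - a) * qpoch (a * q) q"
proof -
  have "(\<lambda>j. 1 - a * q ^ Suc j) has_prod qpoch (a * q) q"
    using convergent_prod_has_prod[OF convergent_prod_qpoch[OF assms, of "a * q"]]
    by (simp add: qpoch_def mult.assoc)
  then have "(\<lambda>j. 1 - a * q ^ j) has_prod (qpoch (a * q) q * (1 - a * q ^ 0))"
    by (rule has_prod_Suc_imp)
  then show ?thesis
    by (simp add: qpoch_def has_prod_iff mult.commute)
qed

lemma qpoch_one: "norm q < 1 \<Longrightarrow> qpoch 1 q = 0"
  using qpoch_step[of q 1] by simp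

lemma qpoch_eq_0_imp:
  assumes "norm q < 1" "qpoch a q = 0"
  shows "\<exists>j. a * q ^ j = 1"
  using prodinf_nonzero[OF convergent_prod_qpoch[OF assms(1), of a]] assms(2)
  unfolding qpoch_def by auto

text \<open>Countability is all that is needed of the exceptional points: a polynomial identity on
  the complement of a countable set holds everywhere.\<close>

lemma countable_qpoch_zeros:
  assumes "norm q < 1"
  shows "countable {x. qpoch (c * x) q = 0}"
proof -
  have "{x. qpoch (c * x) q = 0} \<subseteq> range (\<lambda>j. 1 / (c * q ^ j))"
  proof
    fix x assume "x \<in> {x. qpoch (c * x) q = 0}"
    then obtain j where "c * x * q ^ j = 1"
      using qpoch_eq_0_imp[OF assms] by blast
    moreover from this have "c * q ^ j \<noteq> 0"
      by (metis mult_eq_0_iff one_neq_zero)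
    ultimately have "x = 1 / (c * q ^ j)"
      by (simp add: nonzero_eq_divide_eq mult_ac)
    then show "x \<in> range (\<lambda>j. 1 / (c * q ^ j))" by blast
  qed
  then show ?thesis
    by (rule countable_subset) simp
qed

lemma countable_weight_num_zeros:
  assumes "norm q < 1"
  shows "countable {x. weight_num q b2 b3 b6 t x = 0}"
proof -
  have "{x. weight_num q b2 b3 b6 t x = 0} \<subseteq>
      {x. qpoch (b2 * x) q = 0} \<union> {x. qpoch (b3 * x) q = 0} \<union> {x. qpoch (1 / (b6 * t) * x) q = 0}"
    by (auto simp: weight_num_def)
  then show ?thesis
    by (rule countable_subset) (intro countable_Un countable_qpoch_zeros assms)
qed

lemma countable_weight_den_zeros:
  assumes "norm q < 1"
  shows "countable {x. weight_den q b1 b4 b6 t x = 0}"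
proof -
  have "{x. weight_den q b1 b4 b6 t x = 0} \<subseteq>
      {x. qpoch (b1 * x) q = 0} \<union> {x. qpoch (b4 * x) q = 0} \<union> {x. qpoch (b6 / t * x) q = 0}"
    by (auto simp: weight_den_def)
  then show ?thesis
    by (rule countable_subset) (intro countable_Un countable_qpoch_zeros assms)
qed

lemma weight_num_step:
  assumes "norm q < 1"
  shows "weight_num q b2 b3 b6 t x =
    (1 - b2 * x) * (1 - b3 * x) * (1 - x / (b6 * t)) * weight_num q b2 b3 b6 t (q * x)"
  unfolding weight_num_def
  by (subst (1 2 3) qpoch_step[OF assms]) (simp add: mult_ac)

lemma weight_den_step:
  assumes "norm q < 1"
  shows "weight_den q b1 b4 b6 t x =
    (1 - b1 * x) * (1 - b4 * x) * (1 - b6 * x / t) * weight_den q b1 b4 b6 t (q * x)"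
  unfolding weight_den_def
  by (subst (1 2 3) qpoch_step[OF assms]) (simp add: mult_ac)

text \<open>Up to the common constant \<open>b6 * t\<close>, the linear factors split off by one
  step of the numerator and of the denominator are \<open>D_minus\<close> and \<open>D_plus\<close>.
  Excluding zeros and poles at \<open>x\<close> keeps the convention \<open>x / 0 = 0\<close> out of
  play.\<close>

lemma weight_pearson:
  assumes "norm q < 1" "b6 \<noteq> 0" "t \<noteq> 0"
    and "weight_num q b2 b3 b6 t x \<noteq> 0" "weight_den q b1 b4 b6 t x \<noteq> 0"
  shows "D_minus b2 b3 b6 t x * weight q b1 b2 b3 b4 b6 t (q * x) =
    D_plus b1 b4 b6 t x * weight q b1 b2 b3 b4 b6 t x"
proof -
  let ?N = "weight_num q b2 b3 b6 t (q * x)" and ?D = "weight_den q b1 b4 b6 t (q * x)"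
  have nz: "1 - b1 * x \<noteq> 0" "1 - b4 * x \<noteq> 0" "1 - b6 * x / t \<noteq> 0" "?D \<noteq> 0"
    using assms(5) weight_den_step[OF assms(1), of b1 b4 b6 t x] by auto
  have "t - b6 * x = t * (1 - b6 * x / t)" "b6 * t - x = b6 * t * (1 - x / (b6 * t))"
    using assms(2,3) by (auto simp: field_simps)
  then show ?thesis
    unfolding weight_def D_minus_def D_plus_def
      weight_num_step[OF assms(1), of b2 b3 b6 t x] weight_den_step[OF assms(1), of b1 b4 b6 t x]
    using nz assms(2,3) by simp
qed

text \<open>One factor of the numerator becomes \<open>qpoch 1 q\<close>. Thus \<open>b6 * t\<close>
  carries no mass, even if it is a sample point.\<close>

lemma weight_eq_0_num:
  "norm q < 1 \<Longrightarrow> b6 \<noteq> 0 \<Longrightarrow> t \<noteq> 0 \<Longrightarrow> weight q b1 b2 b3 b4 b6 t (b6 * t) = 0"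
  by (simp add: weight_def weight_num_def qpoch_one)

text \<open>The point \<open>t / b6\<close> is a pole of the weight; the value there is \<open>0\<close> because
  \<open>x / 0 = 0\<close>.\<close>

lemma weight_eq_0_den:
  "norm q < 1 \<Longrightarrow> b6 \<noteq> 0 \<Longrightarrow> t \<noteq> 0 \<Longrightarrow> weight q b1 b2 b3 b4 b6 t (t / b6) = 0"
  by (simp add: weight_def weight_den_def qpoch_one)

text \<open>Ratio test: the sample points tend to \<open>0\<close>, where all linear factors tend to
  \<open>1\<close>, so consecutive terms have a ratio tending to \<open>q\<close>.\<close>

lemma summable_weight:
  assumes "norm q < 1"
  shows "summable (\<lambda>k. norm (q ^ k * weight q b1 b2 b3 b4 b6 t (e * q ^ k)))"
proof -
  let ?w = "weight q b1 b2 b3 b4 b6 t"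
  define \<rho> where "\<rho> = (\<lambda>x. ((1 - b1 * x) * (1 - b4 * x) * (1 - b6 * x / t)) /
    ((1 - b2 * x) * (1 - b3 * x) * (1 - x / (b6 * t))))"
  define y where "y = (\<lambda>k. e * q ^ k)"
  have y0: "y \<longlonglongrightarrow> 0"
    unfolding y_def using assms by (intro tendsto_mult_right_zero LIMSEQ_power_zero)
  have lim: "(\<lambda>k. 1 - c * y k) \<longlonglongrightarrow> 1" for c
    by (rule tendsto_eq_intros y0 refl)+ simp
  have ev: "\<forall>\<^sub>F k in sequentially. 1 - c * y k \<noteq> 0" for c
    using tendsto_imp_eventually_ne[OF lim[of c], of 0] by simp
  \<comment> \<open>When the linear factors are nonzero, \<open>x\<close> is a pole exactly if
    \<open>q * x\<close> is one; both sides are then \<open>0\<close>, so the relation holds at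
    every sample point close to \<open>0\<close>.\<close>
  have step: "?w (q * x) = \<rho> x * ?w x"
    if "1 - b1 * x \<noteq> 0" "1 - b4 * x \<noteq> 0" "1 - b6 * x / t \<noteq> 0"
      "1 - b2 * x \<noteq> 0" "1 - b3 * x \<noteq> 0" "1 - x / (b6 * t) \<noteq> 0" for x
    using that unfolding weight_def \<rho>_def
      weight_num_step[OF assms(1), of b2 b3 b6 t x] weight_den_step[OF assms(1), of b1 b4 b6 t x]
    by auto
  have "(\<lambda>k. \<rho> (y k)) \<longlonglongrightarrow>
      ((1 * 1) * 1) / ((1 * 1) * 1)"
    unfolding \<rho>_def using lim[of "b6 / t"] lim[of "1 / (b6 * t)"]
    by (intro tendsto_divide tendsto_mult lim) simp_all
  then have "(\<lambda>k. norm (q * \<rho> (y k))) \<longlonglongrightarrow> norm (q * 1)"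
    by (intro tendsto_norm tendsto_mult tendsto_const) simp
  moreover obtain c where c: "norm q < c" "c < 1"
    using assms dense by blast
  ultimately have "\<forall>\<^sub>F k in sequentially. norm (q * \<rho> (y k)) < c"
    by (intro order_tendstoD) simp_all
  then have "\<forall>\<^sub>F k in sequentially. norm (q ^ Suc k * ?w (y (Suc k))) \<le> c * norm (q ^ k * ?w (y k))"
    using ev[of b1] ev[of b4] ev[of "b6 / t"] ev[of b2] ev[of b3] ev[of "1 / (b6 * t)"]
  proof eventually_elim
    case (elim k)
    have "?w (y (Suc k)) = \<rho> (y k) * ?w (y k)"
      using step[of "y k"] elim by (simp add: y_def mult_ac)
    then have "norm (q ^ Suc k * ?w (y (Suc k))) = norm (q * \<rho> (y k)) * norm (q ^ k * ?w (y k))"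
      by (simp add: norm_mult norm_power mult_ac)
    also have "\<dots> \<le> c * norm (q ^ k * ?w (y k))"
      using elim(1) by (intro mult_right_mono) simp_all
    finally show ?case .
  qed
  then obtain N where "\<And>k. k \<ge> N \<Longrightarrow>
      norm (norm (q ^ Suc k * ?w (y (Suc k)))) \<le> c * norm (norm (q ^ k * ?w (y k)))"
    by (auto simp: eventually_sequentially)
  then have "summable (\<lambda>k. norm (q ^ k * ?w (y k)))"
    by (intro summable_ratio_test[OF c(2)])
  then show ?thesis
    by (simp add: y_def)
qed

section \<open>Thomae--Jackson integrals\<close>

lemma finite_terminals: "finite (terminals G)"
  unfolding terminals_def by auto

lemma countable_support: "countable (support q G)"
proof -
  have "support q G = {0} \<union> (\<Union>a\<in>terminals G. range (\<lambda>k. a * q ^ k))"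
    unfolding support_def by auto
  then show ?thesis
    by (simp add: countable_finite finite_terminals)
qed

lemma support_terminal: "a \<in> terminals G \<Longrightarrow> a * q ^ k \<in> support q G"
  unfolding support_def by blast

lemma support_bounded:
  assumes "norm q < 1"
  obtains R where "R > 0" "\<And>y. y \<in> support q G \<Longrightarrow> norm y \<le> R"
proof -
  obtain R where R: "R > 0" "\<And>a. a \<in> terminals G \<Longrightarrow> norm a \<le> R"
    using finite_imp_bounded[OF finite_terminals] unfolding bounded_pos by metis
  have "norm y \<le> R" if "y \<in> support q G" for y
  proof -
    consider "y = 0" | a k where "a \<in> terminals G" "y = a * q ^ k"
      using \<open>y \<in> support q G\<close> unfolding support_def by auto
    then show ?thesis
    proof cases
      case 2
      have "norm y \<le> norm a * 1"
        unfolding 2 norm_mult norm_power using assms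
        by (intro mult_left_mono power_le_one) auto
      then show ?thesis using R(2)[OF 2(1)] by simp
    qed (use R in simp)
  qed
  with R(1) show thesis by (rule that)
qed

text \<open>The sample points accumulate only at \<open>0\<close>: finitely many of them lie outside
  the disc of radius \<open>norm x / 2\<close>, and those other than \<open>x\<close> keep a
  positive distance. The point \<open>x\<close> may itself be a sample point.\<close>

lemma support_isolated:
  assumes "norm q < 1" "x \<noteq> 0"
  obtains \<epsilon> where "\<epsilon> > 0" "\<And>y. y \<in> support q G \<Longrightarrow> y \<noteq> x \<Longrightarrow> \<epsilon> \<le> norm (x - y)"
proof -
  let ?K = "\<lambda>a. {k. norm x / 2 \<le> norm (a * q ^ k)}"
  have fin: "finite (?K a)" for a
  proof -
    have "(\<lambda>k. a * q ^ k) \<longlonglongrightarrow> 0"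
      using assms(1) by (intro tendsto_mult_right_zero LIMSEQ_power_zero)
    then have "\<forall>\<^sub>F k in sequentially. norm (a * q ^ k) < norm x / 2"
      using assms(2) by (intro order_tendstoD(2)[OF tendsto_norm_zero]) auto
    then obtain N where "\<And>k. k \<ge> N \<Longrightarrow> norm (a * q ^ k) < norm x / 2"
      by (auto simp: eventually_sequentially)
    then have "?K a \<subseteq> {..<N}"
      by (force simp: not_le[symmetric])
    then show ?thesis by (rule finite_subset) simp
  qed
  let ?S = "\<Union>a\<in>terminals G. (\<lambda>k. a * q ^ k) ` ?K a"
  have "finite ?S"
    by (intro finite_UN_I finite_terminals finite_imageI fin)
  then obtain d where d: "d > 0" "\<And>y. y \<in> ?S \<Longrightarrow> y \<noteq> x \<Longrightarrow> d \<le> dist x y"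
    using finite_set_avoid by meson
  have "min d (norm x / 2) \<le> norm (x - y)" if "y \<in> support q G" "y \<noteq> x" for y
  proof (cases "norm y < norm x / 2")
    case True
    have "norm x - norm y \<le> norm (x - y)"
      by (rule norm_triangle_ineq2)
    with True show ?thesis by linarith
  next
    case False
    then have "y \<noteq> 0" using assms(2) by auto
    with that(1) obtain a k where "a \<in> terminals G" "y = a * q ^ k"
      unfolding support_def by auto
    with False have "y \<in> ?S"
      by (intro UN_I[of a] image_eqI[of _ _ k]) auto
    with d(2) that(2) show ?thesis
      by (simp add: dist_norm min.coboundedI1)
  qed
  moreover have "min d (norm x / 2) > 0"
    using d(1) assms(2) by simp
  ultimately show thesis by (rule that[rotated])
qed

text \<open>Absolute convergence is what survives multiplication by an arbitrary function bounded on
  the support.\<close>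

definition qsummable :: "complex \<Rightarrow> chain \<Rightarrow> (complex \<Rightarrow> complex) \<Rightarrow> bool" where
  "qsummable q G F \<longleftrightarrow> (\<forall>e\<in>terminals G. summable (\<lambda>k. norm (q ^ k * F (e * q ^ k))))"

lemma terminals_Cons [simp]: "terminals ((c, a, b) # G) = {a, b} \<union> terminals G"
  by (auto simp: terminals_def)

lemma qint_Cons [simp]: "qint q ((c, a, b) # G) F = c * jackson q a b F + qint q G F"
  by (simp add: qint_def)

lemma qint_Nil [simp]: "qint q [] F = 0"
  by (simp add: qint_def)

lemma qsummable_Cons [simp]: "qsummable q ((c, a, b) # G) F \<longleftrightarrow>
    summable (\<lambda>k. norm (q ^ k * F (a * q ^ k))) \<and> summable (\<lambda>k. norm (q ^ k * F (b * q ^ k))) \<and>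
    qsummable q G F"
  by (auto simp: qsummable_def)

lemma jackson0_linear:
  assumes "summable (\<lambda>k. norm (q ^ k * F (e * q ^ k)))" "summable (\<lambda>k. norm (q ^ k * H (e * q ^ k)))"
  shows "jackson0 q e (\<lambda>y. c * F y + H y) = c * jackson0 q e F + jackson0 q e H"
proof -
  have F: "summable (\<lambda>k. q ^ k * F (e * q ^ k))" and H: "summable (\<lambda>k. q ^ k * H (e * q ^ k))"
    using assms by (auto intro: summable_norm_cancel)
  have "(\<Sum>k. c * (q ^ k * F (e * q ^ k)) + q ^ k * H (e * q ^ k)) =
      c * (\<Sum>k. q ^ k * F (e * q ^ k)) + (\<Sum>k. q ^ k * H (e * q ^ k))"
    using suminf_add[OF summable_mult[OF F] H] suminf_mult[OF F] by simp
  then show ?thesis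
    unfolding jackson0_def by (simp add: algebra_simps)
qed

lemma qint_linear:
  assumes "qsummable q G F" "qsummable q G H"
  shows "qint q G (\<lambda>y. c * F y + H y) = c * qint q G F + qint q G H"
  using assms
proof (induction G)
  case (Cons x G)
  obtain c' a b where x: "x = (c', a, b)" by (cases x)
  have "qint q G (\<lambda>y. c * F y + H y) = c * qint q G F + qint q G H"
    using Cons unfolding x by simp
  moreover have "jackson q a b (\<lambda>y. c * F y + H y) = c * jackson q a b F + jackson q a b H"
    using Cons.prems unfolding x by (simp add: jackson_def jackson0_linear right_diff_distrib)
  ultimately show ?case
    unfolding x by (simp add: algebra_simps)
qed simp

lemma qsummable_mult_bounded:
  assumes "qsummable q G w" "bounded (F ` support q G)"
  shows "qsummable q G (\<lambda>y. w y * F y)"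
  unfolding qsummable_def
proof
  fix e assume e: "e \<in> terminals G"
  obtain B where B: "\<And>y. y \<in> support q G \<Longrightarrow> norm (F y) \<le> B"
    using assms(2) unfolding bounded_iff by auto
  have "norm (F (e * q ^ k)) \<le> B" for k
    using e by (intro B support_terminal)
  then have le: "norm (q ^ k * (w (e * q ^ k) * F (e * q ^ k))) \<le> norm (q ^ k * w (e * q ^ k)) * B" for k
    unfolding mult.assoc[symmetric] norm_mult[of _ "F _"] by (rule mult_left_mono) simp
  have "summable (\<lambda>k. norm (q ^ k * w (e * q ^ k)) * B)"
    using assms(1) e by (intro summable_mult2) (simp add: qsummable_def)
  then show "summable (\<lambda>k. norm (q ^ k * (w (e * q ^ k) * F (e * q ^ k))))"
    by (rule summable_comparison_test'[where N = 0]) (simp only: real_norm_def abs_norm_cancel le)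
qed

lemma jackson0_bound:
  fixes B :: real
  assumes s: "summable (\<lambda>k. norm (q ^ k * w (e * q ^ k)))"
    and F: "\<And>k. w (e * q ^ k) \<noteq> 0 \<Longrightarrow> norm (F (e * q ^ k)) \<le> B"
  shows "norm (jackson0 q e (\<lambda>y. w y * F y)) \<le>
    norm ((1 - q) * e) * (\<Sum>k. norm (q ^ k * w (e * q ^ k))) * B"
proof -
  have le: "norm (q ^ k * (w (e * q ^ k) * F (e * q ^ k))) \<le> norm (q ^ k * w (e * q ^ k)) * B" for k
  proof (cases "w (e * q ^ k) = 0")
    case False
    then show ?thesis
      unfolding mult.assoc[symmetric] norm_mult[of _ "F _"]
      by (intro mult_left_mono F False norm_ge_zero)
  qed simp
  have s2: "summable (\<lambda>k. norm (q ^ k * w (e * q ^ k)) * B)"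
    using s by (rule summable_mult2)
  have "norm (\<Sum>k. q ^ k * (w (e * q ^ k) * F (e * q ^ k))) \<le> (\<Sum>k. norm (q ^ k * w (e * q ^ k)) * B)"
    by (rule norm_suminf_le[OF le s2])
  also have "\<dots> = (\<Sum>k. norm (q ^ k * w (e * q ^ k))) * B"
    by (rule suminf_mult2[OF s, symmetric])
  finally show ?thesis
    unfolding jackson0_def norm_mult[of "(1 - q) * e"] mult.assoc[of "norm _"]
    by (rule mult_left_mono) simp
qed

text \<open>\<open>M\<close> comes from the absolute mass of \<open>w\<close> along the chain and is
  uniform in \<open>F\<close>. Since \<open>F\<close> is bounded only where \<open>w\<close> is
  nonzero, it may be large at sample points without mass.\<close>

lemma qint_bound:
  assumes "qsummable q G w"
  obtains M where "M \<ge> 0"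
    "\<And>F B. B \<ge> 0 \<Longrightarrow> (\<And>y. y \<in> support q G \<Longrightarrow> w y \<noteq> 0 \<Longrightarrow> norm (F y) \<le> B) \<Longrightarrow>
      norm (qint q G (\<lambda>y. w y * F y)) \<le> M * B"
proof -
  have "\<exists>M\<ge>0. \<forall>F. \<forall>B\<ge>0. (\<forall>e\<in>terminals G. \<forall>k. w (e * q ^ k) \<noteq> 0 \<longrightarrow> norm (F (e * q ^ k)) \<le> B) \<longrightarrow>
      norm (qint q G (\<lambda>y. w y * F y)) \<le> M * B"
    using assms
  proof (induction G)
    case (Cons x G)
    obtain c a b where x: "x = (c, a, b)" by (cases x)
    have "qsummable q G w" using Cons.prems unfolding x by simp
    then obtain M where M: "M \<ge> 0" "\<forall>F. \<forall>B\<ge>0.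
        (\<forall>e\<in>terminals G. \<forall>k. w (e * q ^ k) \<noteq> 0 \<longrightarrow> norm (F (e * q ^ k)) \<le> B) \<longrightarrow>
        norm (qint q G (\<lambda>y. w y * F y)) \<le> M * B"
      using Cons.IH by blast
    define J where "J = (\<lambda>e. norm ((1 - q) * e) * (\<Sum>k. norm (q ^ k * w (e * q ^ k))))"
    have s: "summable (\<lambda>k. norm (q ^ k * w (a * q ^ k)))" "summable (\<lambda>k. norm (q ^ k * w (b * q ^ k)))"
      using Cons.prems unfolding x by simp_all
    have J: "J a \<ge> 0" "J b \<ge> 0"
      unfolding J_def using s by (intro mult_nonneg_nonneg norm_ge_zero suminf_nonneg; simp)+
    show ?case
    proof (intro exI[of _ "norm c * (J b + J a) + M"] conjI allI impI)
      show "norm c * (J b + J a) + M \<ge> 0"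
        using M(1) J by (intro add_nonneg_nonneg mult_nonneg_nonneg norm_ge_zero)
      fix F :: "complex \<Rightarrow> complex" and B :: real
      assume B: "B \<ge> 0"
        and F: "\<forall>e\<in>terminals (x # G). \<forall>k. w (e * q ^ k) \<noteq> 0 \<longrightarrow> norm (F (e * q ^ k)) \<le> B"
      let ?wF = "\<lambda>y. w y * F y"
      have "norm (jackson0 q a ?wF) \<le> J a * B" "norm (jackson0 q b ?wF) \<le> J b * B"
        unfolding J_def using F unfolding x by (intro jackson0_bound s; simp)+
      then have "norm (jackson q a b ?wF) \<le> J b * B + J a * B"
        unfolding jackson_def using norm_triangle_ineq4[of "jackson0 q b ?wF" "jackson0 q a ?wF"]
        by linarith
      then have "norm (c * jackson q a b ?wF) \<le> norm c * (J b * B + J a * B)"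
        by (simp add: norm_mult mult_left_mono)
      moreover have "norm (qint q G ?wF) \<le> M * B"
        using F B unfolding x by (intro M(2)[rule_format]) simp_all
      ultimately have "norm (c * jackson q a b ?wF + qint q G ?wF) \<le>
          norm c * (J b * B + J a * B) + M * B"
        by (rule norm_triangle_mono)
      then show "norm (qint q (x # G) ?wF) \<le> (norm c * (J b + J a) + M) * B"
        unfolding x by (simp add: algebra_simps)
    qed
  qed (rule exI[of _ 0], simp)
  then obtain M where M: "M \<ge> 0" "\<forall>F. \<forall>B\<ge>0.
      (\<forall>e\<in>terminals G. \<forall>k. w (e * q ^ k) \<noteq> 0 \<longrightarrow> norm (F (e * q ^ k)) \<le> B) \<longrightarrow>
      norm (qint q G (\<lambda>y. w y * F y)) \<le> M * B"
    by blast
  show thesis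
  proof (rule that[OF M(1)])
    fix F :: "complex \<Rightarrow> complex" and B :: real
    assume "B \<ge> 0" "\<And>y. y \<in> support q G \<Longrightarrow> w y \<noteq> 0 \<Longrightarrow> norm (F y) \<le> B"
    then show "norm (qint q G (\<lambda>y. w y * F y)) \<le> M * B"
      by (intro M(2)[rule_format]) (simp_all add: support_terminal)
  qed
qed

lemma bounded_poly_support:
  assumes "norm q < 1"
  shows "bounded (poly P ` support q G)"
proof -
  obtain R where R: "\<And>y. y \<in> support q G \<Longrightarrow> norm y \<le> R"
    using support_bounded[OF assms] by metis
  have "bounded (poly P ` cball 0 R)"
    by (intro compact_imp_bounded compact_continuous_image continuous_intros compact_cball)
  then show ?thesis
    by (rule bounded_subset) (use R in auto)
qed

lemma bounded_cauchy_support: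
  assumes "norm q < 1" "x \<notin> support q G"
  shows "bounded ((\<lambda>y. poly P y / (x - y)) ` support q G)"
proof -
  have "x \<noteq> 0" using assms(2) by (auto simp: support_def)
  then obtain \<epsilon> where \<epsilon>: "\<epsilon> > 0" "\<And>y. y \<in> support q G \<Longrightarrow> y \<noteq> x \<Longrightarrow> \<epsilon> \<le> norm (x - y)"
    using support_isolated[OF assms(1)] by metis
  obtain B where B: "\<And>y. y \<in> support q G \<Longrightarrow> norm (poly P y) \<le> B"
    using bounded_poly_support[OF assms(1)] unfolding bounded_iff by (metis image_eqI)
  have "norm (poly P y / (x - y)) \<le> B / \<epsilon>" if y: "y \<in> support q G" for y
    unfolding norm_divide
  proof (rule frac_le)
    show "\<epsilon> \<le> norm (x - y)" using y \<epsilon>(2) assms(2) by blast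
    show "0 \<le> B" using B[OF y] norm_ge_zero order_trans by blast
  qed (use B[OF y] \<epsilon>(1) in auto)
  then show ?thesis unfolding bounded_iff by auto
qed

definition moment :: "complex \<Rightarrow> (complex \<Rightarrow> complex) \<Rightarrow> chain \<Rightarrow> complex poly \<Rightarrow> complex" where
  "moment q w G P = qint q G (\<lambda>y. w y * poly P y)"

lemma moment_linear:
  assumes "norm q < 1" "qsummable q G w"
  shows "moment q w G (smult c P + Q) = c * moment q w G P + moment q w G Q"
proof -
  have "moment q w G (smult c P + Q) = qint q G (\<lambda>y. c * (w y * poly P y) + w y * poly Q y)"
    unfolding moment_def by (simp add: algebra_simps)
  also have "\<dots> = c * moment q w G P + moment q w G Q"
    unfolding moment_def
    by (intro qint_linear qsummable_mult_bounded assms bounded_poly_support)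
  finally show ?thesis .
qed

section \<open>Functions of the second kind\<close>

lemma moment_0 [simp]: "moment q w G 0 = 0"
proof -
  have "qint q G (\<lambda>y. 0) = 0"
    by (induction G) (auto simp: jackson_def jackson0_def)
  then show ?thesis by (simp add: moment_def)
qed

lemma qint_cong:
  assumes "\<And>y. y \<in> support q G \<Longrightarrow> F y = H y"
  shows "qint q G F = qint q G H"
proof -
  have "jackson q a b F = jackson q a b H" if "(c, a, b) \<in> set G" for a b c
  proof -
    have "a \<in> terminals G" "b \<in> terminals G"
      using that by (force simp: terminals_def)+
    then have "F (a * q ^ k) = H (a * q ^ k)" "F (b * q ^ k) = H (b * q ^ k)" for k
      by (auto intro!: assms support_terminal)
    then show ?thesis by (simp add: jackson_def jackson0_def)
  qed
  then show ?thesis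
    unfolding qint_def by (intro arg_cong[of _ _ sum_list] map_cong) auto
qed

lemma second_kind_altdef:
  "second_kind q w G P x = qint q G (\<lambda>y. w y * (poly P y / (x - y)))"
  by (simp add: second_kind_def)

lemma second_kind_linear:
  assumes "norm q < 1" "qsummable q G w" "x \<notin> support q G"
  shows "second_kind q w G (smult c P + Q) x = c * second_kind q w G P x + second_kind q w G Q x"
proof -
  have "second_kind q w G (smult c P + Q) x =
      qint q G (\<lambda>y. c * (w y * (poly P y / (x - y))) + w y * (poly Q y / (x - y)))"
    unfolding second_kind_altdef by (simp add: ring_distribs add_divide_distrib mult_ac)
  also have "\<dots> = c * second_kind q w G P x + second_kind q w G Q x"
    unfolding second_kind_altdef
    by (intro qint_linear qsummable_mult_bounded assms bounded_cauchy_support)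
  finally show ?thesis .
qed

lemma second_kind_0 [simp]: "second_kind q w G 0 x = 0"
  using moment_0[of q w G] by (simp add: moment_def second_kind_def)

lemma stieltjes_eq_second_kind: "stieltjes q w G x = second_kind q w G 1 x"
  by (simp add: stieltjes_def second_kind_def)

text \<open>This is \<open>y / (x - y) = x / (x - y) - 1\<close> under the integral: raising the
  degree by one costs one moment.\<close>

lemma second_kind_pCons_0:
  assumes "norm q < 1" "qsummable q G w" "x \<notin> support q G"
  shows "second_kind q w G (pCons 0 P) x = x * second_kind q w G P x - moment q w G P"
proof -
  have "moment q w G P = second_kind q w G (smult (-1) (pCons 0 P) + smult x P) x"
    unfolding second_kind_def moment_def
  proof (rule qint_cong)
    fix y assume "y \<in> support q G"
    then have "x - y \<noteq> 0" using assms(3) by auto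
    moreover have "poly (smult (-1) (pCons 0 P) + smult x P) y = poly P y * (x - y)"
      by (simp add: algebra_simps)
    ultimately show "w y * poly P y = w y * poly (smult (-1) (pCons 0 P) + smult x P) y / (x - y)"
      by simp
  qed
  also have "\<dots> = - second_kind q w G (pCons 0 P) x + x * second_kind q w G P x"
    using second_kind_linear[OF assms, of "-1" "pCons 0 P" "smult x P"]
      second_kind_linear[OF assms, of x P 0] by simp
  finally show ?thesis by simp
qed

text \<open>Horner recursion on \<open>P\<close>; up to sign, \<open>r\<close> is the associated
  polynomial. The Stieltjes function is thereby the only non-polynomial ingredient, and eliminating
  it yields polynomials.\<close>

lemma second_kind_decomp:
  assumes "norm q < 1" "qsummable q G w"
  obtains r where "\<And>x. x \<notin> support q G \<Longrightarrow>
    second_kind q w G P x = poly P x * stieltjes q w G x + poly r x"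
proof -
  have "\<exists>r. \<forall>x. x \<notin> support q G \<longrightarrow>
    second_kind q w G P x = poly P x * stieltjes q w G x + poly r x"
  proof (induction P)
    case 0
    then show ?case by (intro exI[of _ 0]) simp
  next
    case (pCons c P)
    then obtain r where r: "\<And>x. x \<notin> support q G \<Longrightarrow>
        second_kind q w G P x = poly P x * stieltjes q w G x + poly r x" by blast
    show ?case
    proof (intro exI[of _ "pCons (- moment q w G P) r"] allI impI)
      fix x assume x: "x \<notin> support q G"
      have "second_kind q w G (pCons c P) x =
          c * stieltjes q w G x + second_kind q w G (pCons 0 P) x"
        using second_kind_linear[OF assms x, of c 1 "pCons 0 P"]
        by (simp add: stieltjes_eq_second_kind)
      then show "second_kind q w G (pCons c P) x =
          poly (pCons c P) x * stieltjes q w G x + poly (pCons (- moment q w G P) r) x"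
        unfolding second_kind_pCons_0[OF assms x] r[OF x] by (simp add: algebra_simps)
    qed
  qed
  then show thesis using that by blast
qed

lemma eventually_at_infinity_notin_support:
  assumes "norm q < 1"
  shows "\<forall>\<^sub>F x in at_infinity. x \<notin> support q G"
proof -
  obtain R where "\<And>y. y \<in> support q G \<Longrightarrow> norm y \<le> R"
    using support_bounded[OF assms] by metis
  then show ?thesis
    unfolding eventually_at_infinity by (intro exI[of _ "R + 1"]) force
qed

text \<open>The support is bounded, so the Cauchy kernel is at most \<open>2 / norm x\<close> on it,
  uniformly, once \<open>x\<close> is large.\<close>

lemma second_kind_tendsto_0:
  assumes "norm q < 1" "qsummable q G w"
  shows "((second_kind q w G P) \<longlongrightarrow> 0) at_infinity"
proof -
  obtain R where R: "R > 0" "\<And>y. y \<in> support q G \<Longrightarrow> norm y \<le> R"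
    using support_bounded[OF assms(1)] by metis
  obtain B0 where "\<And>y. y \<in> support q G \<Longrightarrow> norm (poly P y) \<le> B0"
    using bounded_poly_support[OF assms(1)] unfolding bounded_iff by (metis image_eqI)
  then obtain B where B: "B \<ge> 0" "\<And>y. y \<in> support q G \<Longrightarrow> norm (poly P y) \<le> B"
    by (meson max.cobounded1 max.coboundedI2)
  obtain M where M: "M \<ge> 0" "\<And>F B. B \<ge> 0 \<Longrightarrow>
      (\<And>y. y \<in> support q G \<Longrightarrow> w y \<noteq> 0 \<Longrightarrow> norm (F y) \<le> B) \<Longrightarrow>
      norm (qint q G (\<lambda>y. w y * F y)) \<le> M * B"
    using qint_bound[OF assms(2)] by metis
  have "norm (second_kind q w G P x) \<le> M * (B * (2 / norm x))" if x: "norm x \<ge> 2 * R" for x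
    unfolding second_kind_altdef
  proof (rule M(2))
    fix y assume y: "y \<in> support q G"
    have "norm x - norm y \<le> norm (x - y)"
      by (rule norm_triangle_ineq2)
    with R(2)[OF y] x have "norm x / 2 \<le> norm (x - y)" by simp
    then have "norm (poly P y) / norm (x - y) \<le> B / (norm x / 2)"
      using B(2)[OF y] B(1) R(1) x by (intro frac_le) auto
    then show "norm (poly P y / (x - y)) \<le> B * (2 / norm x)"
      by (simp add: norm_divide)
  qed (use B(1) in simp)
  then have "\<forall>\<^sub>F x in at_infinity. norm (second_kind q w G P x) \<le> M * (B * (2 / norm x))"
    unfolding eventually_at_infinity by blast
  moreover have "((\<lambda>x::complex. M * (B * (2 / norm x))) \<longlongrightarrow> 0) at_infinity"
    by (intro tendsto_mult_right_zero tendsto_divide_0[OF tendsto_const]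
        filterlim_at_top_imp_at_infinity filterlim_norm_at_top)
  ultimately show ?thesis by (rule Lim_null_comparison)
qed

lemma second_kind_leading:
  assumes "norm q < 1" "qsummable q G w"
  shows "((\<lambda>x. x * second_kind q w G P x) \<longlongrightarrow> moment q w G P) at_infinity"
proof -
  have "\<forall>\<^sub>F x in at_infinity.
      moment q w G P + second_kind q w G (pCons 0 P) x = x * second_kind q w G P x"
    using eventually_at_infinity_notin_support[OF assms(1), of G]
    by eventually_elim (simp add: second_kind_pCons_0[OF assms])
  moreover have "((\<lambda>x. moment q w G P + second_kind q w G (pCons 0 P) x) \<longlongrightarrow> moment q w G P + 0) at_infinity"
    by (intro tendsto_intros second_kind_tendsto_0 assms)
  ultimately show ?thesis
    by (simp add: tendsto_cong)
qed

text \<open>Each power of \<open>x\<close> taken out of the integral costs a moment, and these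
  moments vanish.\<close>

lemma second_kind_monom:
  assumes "norm q < 1" "qsummable q G w" "x \<notin> support q G"
    and "\<And>j. j < n \<Longrightarrow> moment q w G (monom 1 j * P) = 0"
  shows "second_kind q w G (monom 1 n * P) x = x ^ n * second_kind q w G P x"
  using assms(4)
proof (induction n)
  case (Suc n)
  have "monom 1 (Suc n) * P = pCons 0 (monom 1 n * P)"
    by (simp add: monom_Suc)
  then show ?case
    using Suc by (simp add: second_kind_pCons_0[OF assms(1-3)])
qed (simp add: monom_0)

text \<open>Subtracting the multiple of \<open>p m\<close> that kills the top coefficient lowers the
  degree of \<open>h\<close>; by orthogonality only the multiple of \<open>p n\<close>
  contributes.\<close>

lemma orthonormal_moment:
  assumes "norm q < 1" "qsummable q G w" "orthonormal_polys q w G p \<gamma>" "degree h \<le> n"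
  shows "moment q w G (p n * h) = coeff h n / \<gamma> n"
proof -
  have deg: "degree (p m) = m" "coeff (p m) m = \<gamma> m" "\<gamma> m \<noteq> 0" for m
    using assms(3) unfolding orthonormal_polys_def by metis+
  have orth: "moment q w G (p n * p m) = (if n = m then 1 else 0)" for m
    using assms(3) unfolding orthonormal_polys_def moment_def by (simp add: mult_ac)
  have red: "moment q w G (p n * h) =
      coeff h m / \<gamma> m * moment q w G (p n * p m) +
      moment q w G (p n * (h - smult (coeff h m / \<gamma> m) (p m)))" for h m
  proof -
    have "p n * h = smult (coeff h m / \<gamma> m) (p n * p m) + p n * (h - smult (coeff h m / \<gamma> m) (p m))"
      by (simp add: algebra_simps)
    then show ?thesis using moment_linear[OF assms(1,2)] by metis
  qed
  have deg_red: "coeff (h - smult (coeff h m / \<gamma> m) (p m)) i = 0"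
    if "\<forall>i\<ge>Suc m. coeff h i = 0" "i \<ge> m" for h i m
    using that deg[of m] by (cases "i = m") (auto simp: coeff_eq_0)
  \<comment> \<open>The bound is put on coefficients instead of the degree so that the induction can
    start at \<open>h = 0\<close>.\<close>
  have low: "moment q w G (p n * h) = 0" if "m \<le> n" "\<forall>i\<ge>m. coeff h i = 0" for h m
    using that
  proof (induction m arbitrary: h)
    case 0
    then have "h = 0" by (intro poly_eqI) simp
    then show ?case by simp
  next
    case (Suc m)
    have "moment q w G (p n * (h - smult (coeff h m / \<gamma> m) (p m))) = 0"
    proof (rule Suc.IH)
      show "m \<le> n" using Suc.prems(1) by simp
      show "\<forall>i\<ge>m. coeff (h - smult (coeff h m / \<gamma> m) (p m)) i = 0"
        using deg_red[OF Suc.prems(2)] by blast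
    qed
    moreover have "moment q w G (p n * p m) = 0"
      using orth[of m] Suc.prems(1) by simp
    ultimately show ?case
      using red[of h m] by simp
  qed
  have "\<forall>i\<ge>Suc n. coeff h i = 0" using assms(4) by (simp add: coeff_eq_0)
  then have "moment q w G (p n * (h - smult (coeff h n / \<gamma> n) (p n))) = 0"
    using deg_red by (intro low[of n]) blast+
  moreover have "moment q w G (p n * p n) = 1"
    using orth[of n] by simp
  ultimately show ?thesis
    using red[of h n] by simp
qed

text \<open>Orthogonality to lower powers lets \<open>x ^ n\<close> pass through the integral; one
  more factor \<open>x\<close> extracts the moment of \<open>monom 1 n * p n\<close>, which is
  \<open>1 / \<gamma> n\<close>.\<close>

lemma second_kind_orthonormal_leading:
  assumes "norm q < 1" "qsummable q G w" "orthonormal_polys q w G p \<gamma>"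
  shows "((\<lambda>x. x ^ Suc n * second_kind q w G (p n) x) \<longlongrightarrow> 1 / \<gamma> n) at_infinity"
proof -
  have mom: "moment q w G (monom 1 j * p n) = (if j = n then 1 / \<gamma> n else 0)" if "j \<le> n" for j
    using orthonormal_moment[OF assms, of "monom 1 j" n] that
    by (simp add: degree_monom_eq mult.commute)
  have "\<forall>\<^sub>F x in at_infinity.
      x * second_kind q w G (monom 1 n * p n) x = x ^ Suc n * second_kind q w G (p n) x"
    using eventually_at_infinity_notin_support[OF assms(1), of G]
    by eventually_elim (simp add: second_kind_monom[OF assms(1,2)] mom)
  moreover have "((\<lambda>x. x * second_kind q w G (monom 1 n * p n) x) \<longlongrightarrow> 1 / \<gamma> n) at_infinity"
    using second_kind_leading[OF assms(1,2), of "monom 1 n * p n"] mom[of n] by simp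
  ultimately show ?thesis
    by (rule Lim_transform_eventually[rotated])
qed

text \<open>The only sample point that could make the kernel large near \<open>x0\<close> is
  \<open>x0\<close> itself, and it has no mass.\<close>

lemma stieltjes_locally_bounded:
  assumes "norm q < 1" "qsummable q G w" "x0 \<noteq> 0" "w x0 = 0"
  obtains \<epsilon> M where "\<epsilon> > 0" "\<And>x. norm (x - x0) < \<epsilon> \<Longrightarrow> norm (stieltjes q w G x) \<le> M"
proof -
  obtain \<epsilon> where \<epsilon>: "\<epsilon> > 0" "\<And>y. y \<in> support q G \<Longrightarrow> y \<noteq> x0 \<Longrightarrow> \<epsilon> \<le> norm (x0 - y)"
    using support_isolated[OF assms(1,3)] by metis
  obtain M where M: "\<And>F B. B \<ge> 0 \<Longrightarrow>
      (\<And>y. y \<in> support q G \<Longrightarrow> w y \<noteq> 0 \<Longrightarrow> norm (F y) \<le> B) \<Longrightarrow>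
      norm (qint q G (\<lambda>y. w y * F y)) \<le> M * B"
    using qint_bound[OF assms(2)] by metis
  have "norm (stieltjes q w G x) \<le> M * (1 / (\<epsilon> / 2))" if x: "norm (x - x0) < \<epsilon> / 2" for x
  proof -
    have "norm (qint q G (\<lambda>y. w y * (1 / (x - y)))) \<le> M * (1 / (\<epsilon> / 2))"
    proof (rule M)
      fix y assume y: "y \<in> support q G" "w y \<noteq> 0"
      then have "y \<noteq> x0" using assms(4) by auto
      have "norm (x0 - y) \<le> norm (x0 - x) + norm (x - y)"
        using norm_triangle_ineq[of "x0 - x" "x - y"] by simp
      with \<epsilon>(2)[OF y(1) \<open>y \<noteq> x0\<close>] x have "\<epsilon> / 2 \<le> norm (x - y)"
        by (simp add: norm_minus_commute)
      then show "norm (1 / (x - y)) \<le> 1 / (\<epsilon> / 2)"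
        unfolding norm_divide using \<epsilon>(1) by (intro frac_le) auto
    qed (use \<epsilon>(1) in simp)
    then show ?thesis by (simp add: stieltjes_def)
  qed
  then show thesis using \<epsilon>(1) by (intro that[of "\<epsilon> / 2"]) auto
qed

text \<open>The factor \<open>c\<close> covers the two arguments \<open>x\<close> and
  \<open>q * x\<close> that occur together in the compatibility relation.\<close>

lemma Bfun_stieltjes:
  assumes "norm q < 1" "qsummable q G w" "c * x0 \<noteq> 0" "w (c * x0) = 0"
  shows "Bfun (\<lambda>x. stieltjes q w G (c * x)) (at x0 within S)"
proof -
  obtain \<epsilon> M where \<epsilon>: "\<epsilon> > 0"
    "\<And>x. norm (x - c * x0) < \<epsilon> \<Longrightarrow> norm (stieltjes q w G x) \<le> M"
    using stieltjes_locally_bounded[OF assms] by metis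
  have "((\<lambda>x. c * x) \<longlongrightarrow> c * x0) (at x0 within S)"
    by (intro tendsto_intros)
  then have "\<forall>\<^sub>F x in at x0 within S. dist (c * x) (c * x0) < \<epsilon>"
    using \<epsilon>(1) by (rule tendstoD)
  then have "\<forall>\<^sub>F x in at x0 within S. norm (stieltjes q w G (c * x)) \<le> M"
    by eventually_elim (auto simp: dist_norm intro: \<epsilon>(2))
  then show ?thesis by (rule BfunI)
qed

section \<open>Polynomials off countable sets\<close>

lemma uncountable_diff_countable_nonempty:
  assumes "uncountable B" "countable (- S)"
  shows "\<exists>x\<in>S. x \<in> B"
  using assms countable_subset[of B "- S"] by auto

lemma islimpt_cocountable:
  fixes \<alpha> :: complex
  assumes "countable (- S)"
  shows "\<alpha> islimpt S"
  unfolding islimpt_approachable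
proof (intro allI impI)
  fix e :: real assume "e > 0"
  then have "uncountable (ball \<alpha> e)" by (rule uncountable_ball)
  moreover have "countable (- (S - {\<alpha>}))"
  proof -
    have "- (S - {\<alpha>}) = insert \<alpha> (- S)" by auto
    then show ?thesis using assms by simp
  qed
  ultimately obtain x where "x \<in> S - {\<alpha>}" "x \<in> ball \<alpha> e"
    using uncountable_diff_countable_nonempty by blast
  then show "\<exists>x'\<in>S. x' \<noteq> \<alpha> \<and> dist x' \<alpha> < e"
    by (auto simp: dist_commute)
qed

text \<open>Every neighbourhood of infinity contains an uncountable ball and hence meets
  \<open>S\<close>; so limits at infinity along \<open>S\<close> are unique.\<close>

lemma at_infinity_cocountable_neq_bot:
  fixes S :: "complex set"
  assumes "countable (- S)"
  shows "inf at_infinity (principal S) \<noteq> bot"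
proof
  assume "inf at_infinity (principal S) = bot"
  then have "\<forall>\<^sub>F x in inf at_infinity (principal S). False" by simp
  then obtain b where b: "\<And>x. b \<le> norm x \<Longrightarrow> x \<notin> S"
    unfolding eventually_inf_principal eventually_at_infinity by blast
  have "uncountable (ball (of_real (\<bar>b\<bar> + 1)) 1 :: complex set)"
    by (rule uncountable_ball) simp
  from uncountable_diff_countable_nonempty[OF this assms]
  obtain x where x: "x \<in> S" "dist (of_real (\<bar>b\<bar> + 1)) x < 1"
    unfolding mem_ball by blast
  have "norm (of_real (\<bar>b\<bar> + 1) :: complex) - norm x \<le> dist (of_real (\<bar>b\<bar> + 1)) x"
    unfolding dist_norm by (rule norm_triangle_ineq2)
  then have "b \<le> norm x"
    using x(2) by (simp only: norm_of_real)
  with b x(1) show False by blast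
qed

lemma poly_eqI_cocountable:
  fixes P Q :: "complex poly"
  assumes "countable (- S)" "\<And>x. x \<in> S \<Longrightarrow> poly P x = poly Q x"
  shows "P = Q"
proof (rule ccontr)
  assume "P \<noteq> Q"
  then have "finite {x. poly (P - Q) x = 0}"
    by (intro poly_roots_finite) simp
  moreover have "S \<subseteq> {x. poly (P - Q) x = 0}" using assms(2) by auto
  ultimately have "countable S" by (metis countable_finite finite_subset)
  then have "countable (S \<union> - S)" using assms(1) by (rule countable_Un)
  then show False using uncountable_UNIV_complex by (simp only: Compl_partition)
qed

lemma poly_degree_0: "degree P = 0 \<Longrightarrow> poly P x = coeff P 0"
  by (auto elim: degree_eq_zeroE)

lemma poly_degree_le_1:
  fixes P :: "'a::comm_semiring_1 poly"
  assumes "degree P \<le> 1"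
  shows "poly P x = poly P 0 + coeff P 1 * x"
proof -
  obtain c M where P: "P = pCons c M" by (cases P rule: pCons_cases)
  with assms have "degree M = 0" by (cases "M = 0") auto
  then show ?thesis unfolding P by (simp add: poly_degree_0 mult.commute)
qed

lemma poly_tendsto_coeff:
  fixes P :: "complex poly"
  assumes "degree P \<le> m"
  shows "((\<lambda>x. poly P x / x ^ m) \<longlongrightarrow> coeff P m) at_infinity"
  using assms
proof (induction P arbitrary: m)
  case (pCons c P)
  show ?case
  proof (cases m)
    case 0
    with pCons.prems have "P = 0" by (simp split: if_splits)
    with 0 show ?thesis by simp
  next
    case (Suc k)
    have deg: "degree P \<le> k"
      using pCons.prems unfolding Suc by (cases "P = 0") auto
    have "((\<lambda>x. c * inverse x ^ m + poly P x / x ^ k) \<longlongrightarrow> c * 0 ^ m + coeff P k) at_infinity"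
      by (intro tendsto_intros tendsto_inverse_0 pCons.IH deg)
    moreover have "\<forall>\<^sub>F x in at_infinity.
        c * inverse x ^ m + poly P x / x ^ k = poly (pCons c P) x / x ^ m"
      unfolding eventually_at_infinity
    proof (intro exI[of _ 1] allI impI)
      fix x :: complex assume "1 \<le> norm x"
      then have "x \<noteq> 0" by auto
      then show "c * inverse x ^ m + poly P x / x ^ k = poly (pCons c P) x / x ^ m"
        unfolding Suc by (simp add: field_simps)
    qed
    ultimately have "((\<lambda>x. poly (pCons c P) x / x ^ m) \<longlongrightarrow> c * 0 ^ m + coeff P k) at_infinity"
      by (rule Lim_transform_eventually)
    then show ?thesis unfolding Suc by simp
  qed
qed simp

text \<open>This plays the role of Liouville's theorem: growth along any proper filter refining
  \<open>at_infinity\<close> fixes a bound on the degree and the coefficient at that bound.\<close>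

lemma poly_degree_le_of_tendsto:
  fixes P :: "complex poly"
  assumes "F \<noteq> bot" "F \<le> at_infinity" "((\<lambda>x. poly P x / x ^ d) \<longlongrightarrow> L) F"
  shows "degree P \<le> d" "coeff P d = L"
proof -
  show deg: "degree P \<le> d"
  proof (rule ccontr)
    assume "\<not> degree P \<le> d"
    then obtain k where k: "degree P = d + Suc k"
      by (metis add_Suc_right less_imp_Suc_add not_le)
    \<comment> \<open>If the degree exceeded \<open>d\<close> by \<open>Suc k\<close>, the extra
      negative powers would send the normalized polynomial to \<open>0\<close>, against its nonzero
      leading coefficient.\<close>
    have "((\<lambda>x::complex. inverse x ^ Suc k) \<longlongrightarrow> 0 ^ Suc k) F"
      by (intro tendsto_intros tendsto_mono[OF assms(2)] tendsto_inverse_0)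
    then have "((\<lambda>x. poly P x / x ^ d * inverse x ^ Suc k) \<longlongrightarrow> L * 0 ^ Suc k) F"
      by (intro tendsto_mult assms(3))
    then have "((\<lambda>x. poly P x / x ^ degree P) \<longlongrightarrow> 0) F"
      unfolding k by (simp add: power_add divide_inverse power_inverse mult_ac)
    moreover have "((\<lambda>x. poly P x / x ^ degree P) \<longlongrightarrow> lead_coeff P) F"
      by (intro tendsto_mono[OF assms(2)] poly_tendsto_coeff order_refl)
    ultimately have "lead_coeff P = 0"
      using assms(1) tendsto_unique by blast
    then show False using k by (metis leading_coeff_0_iff degree_0 add_Suc_right nat.distinct(1))
  qed
  show "coeff P d = L"
    using tendsto_unique[OF assms(1) tendsto_mono[OF assms(2) poly_tendsto_coeff[OF deg]] assms(3)] .
qed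

lemma Bfun_mult:
  fixes f g :: "'a \<Rightarrow> complex"
  assumes "Bfun f F" "Bfun g F"
  shows "Bfun (\<lambda>x. f x * g x) F"
proof -
  from assms obtain A B where "\<forall>\<^sub>F x in F. norm (f x) \<le> A" "\<forall>\<^sub>F x in F. norm (g x) \<le> B"
    by (auto elim!: BfunE)
  then have "\<forall>\<^sub>F x in F. norm (f x * g x) \<le> A * B"
    by eventually_elim
      (auto simp: norm_mult intro!: mult_mono intro: order_trans[OF norm_ge_zero])
  then show ?thesis by (rule BfunI)
qed

lemma Bfun_diff:
  fixes f g :: "'a \<Rightarrow> complex"
  assumes "Bfun f F" "Bfun g F"
  shows "Bfun (\<lambda>x. f x - g x) F"
proof -
  from assms obtain A B where "\<forall>\<^sub>F x in F. norm (f x) \<le> A" "\<forall>\<^sub>F x in F. norm (g x) \<le> B"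
    by (auto elim!: BfunE)
  then have "\<forall>\<^sub>F x in F. norm (f x - g x) \<le> A + B"
    by eventually_elim (meson add_mono norm_triangle_ineq4 order_trans)
  then show ?thesis by (rule BfunI)
qed

lemma Bfun_tendsto:
  fixes f :: "'a \<Rightarrow> complex"
  assumes "(f \<longlongrightarrow> L) F"
  shows "Bfun f F"
proof -
  have "\<forall>\<^sub>F x in F. norm (f x) < norm L + 1"
    using tendsto_norm[OF assms] by (rule order_tendstoD) simp
  then have "\<forall>\<^sub>F x in F. norm (f x) \<le> norm L + 1"
    by eventually_elim simp
  then show ?thesis by (rule BfunI)
qed

text \<open>As \<open>x\<close> tends to \<open>\<alpha>\<close> through \<open>S\<close>, the
  factor \<open>A\<close> tends to \<open>0\<close> while \<open>h\<close> stays bounded; continuity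
  of \<open>V\<close> does the rest.\<close>

lemma poly_root_of_bounded_quotient:
  fixes V :: "complex poly"
  assumes "countable (- S)" "\<And>x. x \<in> S \<Longrightarrow> poly V x = poly A x * h x"
    and "Bfun h (at \<alpha> within S)" "poly A \<alpha> = 0"
  shows "poly V \<alpha> = 0"
proof -
  have "(poly A \<longlongrightarrow> poly A \<alpha>) (at \<alpha> within S)"
    by (intro tendsto_intros)
  then have "Zfun (poly A) (at \<alpha> within S)"
    using assms(4) by (simp add: tendsto_Zfun_iff)
  then have "Zfun (\<lambda>x. poly A x * h x) (at \<alpha> within S)"
    using assms(3) by (rule bounded_bilinear.Zfun_prod_Bfun[OF bounded_bilinear_mult])
  then have "((\<lambda>x. poly A x * h x) \<longlongrightarrow> 0) (at \<alpha> within S)"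
    by (simp add: tendsto_Zfun_iff)
  moreover have "\<forall>\<^sub>F x in at \<alpha> within S. poly A x * h x = poly V x"
    unfolding eventually_at_filter using assms(2) by (intro always_eventually) auto
  ultimately have "(poly V \<longlongrightarrow> 0) (at \<alpha> within S)"
    by (rule Lim_transform_eventually)
  moreover have "(poly V \<longlongrightarrow> poly V \<alpha>) (at \<alpha> within S)"
    by (intro tendsto_intros)
  moreover have "at \<alpha> within S \<noteq> bot"
    using islimpt_cocountable[OF assms(1)] by (simp add: trivial_limit_within)
  ultimately show ?thesis
    using tendsto_unique by blast
qed

text \<open>The roots are removed one after the other, which also covers
  \<open>\<alpha> = \<beta>\<close>: after the first division the quotient is still a vanishing
  factor times the bounded \<open>h\<close>.\<close>

lemma poly_quotient_of_bounded:
  fixes V :: "complex poly"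
  assumes "countable (- S)" "\<alpha> \<notin> S" "\<beta> \<notin> S"
    and V: "\<And>x. x \<in> S \<Longrightarrow> poly V x = (x - \<alpha>) * (x - \<beta>) * h x"
    and "Bfun h (at \<alpha> within S)" "Bfun h (at \<beta> within S)"
  obtains H where "\<And>x. x \<in> S \<Longrightarrow> poly H x = h x"
proof -
  have "poly V \<alpha> = 0"
    using assms(1) _ assms(5)
    by (rule poly_root_of_bounded_quotient[where A = "[:- \<alpha>, 1:] * [:- \<beta>, 1:]"])
      (simp_all add: V algebra_simps)
  then obtain V1 where V1: "V = [:- \<alpha>, 1:] * V1"
    by (auto simp: poly_eq_0_iff_dvd)
  have V1_eq: "poly V1 x = (x - \<beta>) * h x" if "x \<in> S" for x
  proof -
    have "x - \<alpha> \<noteq> 0" using that assms(2) by auto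
    moreover have "(x - \<alpha>) * poly V1 x = (x - \<alpha>) * ((x - \<beta>) * h x)"
      using V[OF that] unfolding V1 by (simp add: algebra_simps)
    ultimately show ?thesis using mult_left_cancel by blast
  qed
  have "poly V1 \<beta> = 0"
    using assms(1) _ assms(6)
    by (rule poly_root_of_bounded_quotient[where A = "[:- \<beta>, 1:]"]) (simp_all add: V1_eq)
  then obtain H where H: "V1 = [:- \<beta>, 1:] * H"
    by (auto simp: poly_eq_0_iff_dvd)
  have "poly H x = h x" if "x \<in> S" for x
  proof -
    have "x - \<beta> \<noteq> 0" using that assms(3) by auto
    moreover have "(x - \<beta>) * poly H x = (x - \<beta>) * h x"
      using V1_eq[OF that] unfolding H by (simp add: algebra_simps)
    ultimately show ?thesis using mult_left_cancel by blast
  qed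
  then show thesis by (rule that)
qed

section \<open>The spectral matrix\<close>

text \<open>The Stieltjes parts cancel, leaving a polynomial; its finite limit at infinity makes it
  constant and gives its value.\<close>

lemma casoratian:
  assumes "norm q < 1" "qsummable q G w" "orthonormal_polys q w G p \<gamma>" "x \<notin> support q G"
  shows "poly (p (Suc n)) x * second_kind q w G (p n) x -
    poly (p n) x * second_kind q w G (p (Suc n)) x = \<gamma> (Suc n) / \<gamma> n"
proof -
  have deg: "degree (p m) = m" "coeff (p m) m = \<gamma> m" for m
    using assms(3) unfolding orthonormal_polys_def by metis+
  obtain r where r: "\<And>x. x \<notin> support q G \<Longrightarrow>
      second_kind q w G (p n) x = poly (p n) x * stieltjes q w G x + poly r x"
    using second_kind_decomp[OF assms(1,2)] by metis
  obtain r' where r': "\<And>x. x \<notin> support q G \<Longrightarrow>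
      second_kind q w G (p (Suc n)) x = poly (p (Suc n)) x * stieltjes q w G x + poly r' x"
    using second_kind_decomp[OF assms(1,2)] by metis
  define C where "C = p (Suc n) * r - p n * r'"
  have C: "poly C x = poly (p (Suc n)) x * second_kind q w G (p n) x -
      poly (p n) x * second_kind q w G (p (Suc n)) x" if "x \<notin> support q G" for x
    unfolding C_def r[OF that] r'[OF that] by (simp add: algebra_simps)
  \<comment> \<open>The second product is two powers smaller than the first:
    \<open>second_kind\<close> of \<open>p (Suc n)\<close> decays like \<open>x\<close> to the power
    \<open>-(n + 2)\<close>, against the degree \<open>n\<close> of \<open>p n\<close>.\<close>
  have "((\<lambda>x. (poly (p (Suc n)) x / x ^ Suc n) * (x ^ Suc n * second_kind q w G (p n) x) -
      (poly (p n) x / x ^ n) * ((x ^ Suc (Suc n) * second_kind q w G (p (Suc n)) x) * inverse x ^ 2)) \<longlongrightarrow>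
      coeff (p (Suc n)) (Suc n) * (1 / \<gamma> n) - coeff (p n) n * (1 / \<gamma> (Suc n) * 0 ^ 2)) at_infinity"
    by (intro tendsto_intros poly_tendsto_coeff second_kind_orthonormal_leading[OF assms(1-3)]
        tendsto_inverse_0) (simp_all add: deg)
  moreover have "\<forall>\<^sub>F x in at_infinity. x \<noteq> (0::complex)"
    unfolding eventually_at_infinity by (intro exI[of _ 1]) auto
  then have "\<forall>\<^sub>F x in at_infinity.
      (poly (p (Suc n)) x / x ^ Suc n) * (x ^ Suc n * second_kind q w G (p n) x) -
      (poly (p n) x / x ^ n) * ((x ^ Suc (Suc n) * second_kind q w G (p (Suc n)) x) * inverse x ^ 2) =
      poly C x / x ^ 0"
    using eventually_at_infinity_notin_support[OF assms(1), of G]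
  proof eventually_elim
    case (elim x)
    have "x ^ Suc (Suc n) * inverse x ^ 2 = x ^ n"
      using elim(1) by (simp add: power2_eq_square field_simps)
    then show ?case
      using elim(1) by (simp add: C[OF elim(2)] power2_eq_square field_simps)
  qed
  ultimately have "((\<lambda>x. poly C x / x ^ 0) \<longlongrightarrow>
      coeff (p (Suc n)) (Suc n) * (1 / \<gamma> n) - coeff (p n) n * (1 / \<gamma> (Suc n) * 0 ^ 2)) at_infinity"
    by (rule Lim_transform_eventually)
  from poly_degree_le_of_tendsto[OF _ order_refl this]
  have "degree C = 0" "coeff C 0 = \<gamma> (Suc n) / \<gamma> n"
    by (simp_all add: deg trivial_limit_at_infinity)
  then have "poly C x = \<gamma> (Suc n) / \<gamma> n"
    by (simp add: poly_degree_0)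
  then show ?thesis using C[OF assms(4)] by simp
qed

text \<open>This treats the second row of \<open>Y_mat\<close> uniformly in \<open>n\<close>. At
  \<open>n = 0\<close> the constant \<open>\<alpha>\<close> is free, and the normalization of the
  row is what makes the Casoratian equal to \<open>1 / \<alpha>\<close> there too.\<close>

lemma second_kind_prev:
  assumes "norm q < 1" "qsummable q G w" "orthonormal_polys q w G p \<gamma>" "\<alpha> \<noteq> 0"
    and "n \<ge> 1 \<Longrightarrow> \<alpha> = \<gamma> (n - 1) / \<gamma> n"
    and pm: "pm = (if n = 0 then 0 else p (n - 1))"
    and v: "v = (\<lambda>x. if n = 0 then 1 / (\<alpha> * \<gamma> 0) else second_kind q w G (p (n - 1)) x)"
  shows second_kind_prev_decomp:
      "\<exists>r. \<forall>x. x \<notin> support q G \<longrightarrow> v x = poly pm x * stieltjes q w G x + poly r x"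
    and casoratian_prev: "x \<notin> support q G \<Longrightarrow>
      poly (p n) x * v x - poly pm x * second_kind q w G (p n) x = 1 / \<alpha>"
    and second_kind_prev_leading: "((\<lambda>x. x ^ n * v x) \<longlongrightarrow> 1 / (\<alpha> * \<gamma> n)) at_infinity"
    and poly_prev_leading: "((\<lambda>x. poly pm x / x ^ n) \<longlongrightarrow> 0) at_infinity"
proof -
  have deg: "degree (p m) = m" "coeff (p m) m = \<gamma> m" "\<gamma> m \<noteq> 0" for m
    using assms(3) unfolding orthonormal_polys_def by metis+
  show "\<exists>r. \<forall>x. x \<notin> support q G \<longrightarrow> v x = poly pm x * stieltjes q w G x + poly r x"
  proof (cases n)
    case 0
    then show ?thesis unfolding pm v by (intro exI[of _ "[:1 / (\<alpha> * \<gamma> 0):]"]) simp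
  next
    case (Suc m)
    obtain r where "\<And>x. x \<notin> support q G \<Longrightarrow>
        second_kind q w G (p m) x = poly (p m) x * stieltjes q w G x + poly r x"
      using second_kind_decomp[OF assms(1,2)] by metis
    then show ?thesis unfolding pm v Suc by auto
  qed
  show "poly (p n) x * v x - poly pm x * second_kind q w G (p n) x = 1 / \<alpha>"
    if x: "x \<notin> support q G"
  proof (cases n)
    case 0
    have "poly (p 0) x = \<gamma> 0"
      using deg[of 0] by (simp add: poly_degree_0)
    with 0 show ?thesis unfolding pm v using deg(3)[of 0] by simp
  next
    case (Suc m)
    then show ?thesis
      unfolding pm v using casoratian[OF assms(1-3) x, of m] assms(5) by simp
  qed
  show "((\<lambda>x. x ^ n * v x) \<longlongrightarrow> 1 / (\<alpha> * \<gamma> n)) at_infinity"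
  proof (cases n)
    case 0
    then show ?thesis unfolding v by simp
  next
    case (Suc m)
    then show ?thesis
      unfolding v using second_kind_orthonormal_leading[OF assms(1-3), of m] assms(5) deg(3)[of n]
      by simp
  qed
  have "degree pm \<le> n" "coeff pm n = 0"
    unfolding pm using deg[of "n - 1"] by (auto intro: coeff_eq_0)
  then show "((\<lambda>x. poly pm x / x ^ n) \<longlongrightarrow> 0) at_infinity"
    using poly_tendsto_coeff[of pm n] by simp
qed

lemma spectral_entries:
  fixes d x :: complex
  assumes "mat d ** (vector [vector [p', u'], vector [m', v']] :: complex^2^2) =
    eval_mat (vector [vector [Wp, - Tp], vector [Tm, Wm]]) x **
    vector [vector [p, u], vector [m, v]]"
  shows "d * p' = poly Wp x * p - poly Tp x * m" "d * u' = poly Wp x * u - poly Tp x * v"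
    "d * m' = poly Tm x * p + poly Wm x * m" "d * v' = poly Tm x * u + poly Wm x * v"
  using assms
  by (simp_all add: vec_eq_iff matrix_matrix_mult_def mat_def eval_mat_def sum_2 forall_2 vector_2)

lemma weight_num_nonzero_imp_D_minus:
  assumes "norm q < 1" "b6 \<noteq> 0" "t \<noteq> 0" "weight_num q b2 b3 b6 t x \<noteq> 0"
  shows "D_minus b2 b3 b6 t x \<noteq> 0"
  using assms(2,3,4) weight_num_step[OF assms(1), of b2 b3 b6 t x]
  by (auto simp: D_minus_def)

lemma weight_den_nonzero_imp_D_plus:
  assumes "norm q < 1" "b6 \<noteq> 0" "t \<noteq> 0" "weight_den q b1 b4 b6 t x \<noteq> 0"
  shows "D_plus b1 b4 b6 t x \<noteq> 0"
  using assms(2,3,4) weight_den_step[OF assms(1), of b1 b4 b6 t x]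
  by (auto simp: D_plus_def)

text \<open>By the Pearson equation, removing the weight from the second column turns the prefactor
  \<open>Dp\<close> into \<open>Dm\<close>.\<close>

lemma spectral_second_column:
  fixes w w' Dp Dm :: complex
  assumes "Dm * w' = Dp * w" "Dp \<noteq> 0" "w \<noteq> 0" "w' \<noteq> 0" "Dp * (y' / w') = A * (y / w) + B * (z / w)"
  shows "Dm * y' = A * y + B * z"
proof -
  have "Dp * y' * w = (A * y + B * z) * w'"
    using assms(3,4,5) by (simp add: field_simps)
  then have "Dp * w * (Dm * y') = (A * y + B * z) * (Dm * w')"
    by (simp add: mult_ac)
  also have "\<dots> = Dp * w * (A * y + B * z)"
    unfolding assms(1) by (rule mult.commute)
  finally show ?thesis using assms(2,3) by simp
qed

text \<open>Take determinants of the spectral relation: the Casoratian has the same value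
  \<open>k\<close> at both arguments and cancels.\<close>

lemma spectral_det:
  fixes W :: complex
  assumes "k \<noteq> 0" "p * v - m * u = k" "p' * v' - m' * u' = k"
    and "Dp * p' = W * p - T * m" "Dp * m' = Tm * p + Wm * m"
    and "Dm * u' = W * u - T * v" "Dm * v' = Tm * u + Wm * v"
  shows "W * Wm + T * Tm = Dp * Dm"
proof -
  have "Dp * Dm * k = (Dp * p') * (Dm * v') - (Dp * m') * (Dm * u')"
    unfolding assms(3)[symmetric] by (simp add: algebra_simps)
  also have "\<dots> = (W * Wm + T * Tm) * (p * v - m * u)"
    unfolding assms(4-7) by (simp add: algebra_simps)
  finally show ?thesis using assms(1,2) by simp
qed

text \<open>This applies the first row of the adjugate of the spectral matrix to the two shifted
  columns.\<close>

lemma spectral_inverse: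
  fixes W :: complex
  assumes "Dp \<noteq> 0" "Dm \<noteq> 0" "W * Wm + T * Tm = Dp * Dm"
    and "Dp * p' = W * p - T * m" "Dp * m' = Tm * p + Wm * m"
    and "Dm * u' = W * u - T * v" "Dm * v' = Tm * u + Wm * v"
  shows "p' * Wm + m' * T = Dm * p" "u' * Wm + v' * T = Dp * u"
proof -
  have "Dp * (p' * Wm + m' * T) = (Dp * p') * Wm + (Dp * m') * T" by (simp add: algebra_simps)
  also have "\<dots> = (W * Wm + T * Tm) * p" unfolding assms(4,5) by (simp add: algebra_simps)
  finally show "p' * Wm + m' * T = Dm * p" using assms(1,3) by simp
  have "Dm * (u' * Wm + v' * T) = (Dm * u') * Wm + (Dm * v') * T" by (simp add: algebra_simps)
  also have "\<dots> = (W * Wm + T * Tm) * u" unfolding assms(6,7) by (simp add: algebra_simps)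
  finally show "u' * Wm + v' * T = Dp * u" using assms(2,3) by simp
qed

section \<open>The q-difference equation\<close>

theorem proposition2:
  fixes q b1 b2 b3 b4 b5 b6 t :: complex
    and n :: nat
    and w :: "complex \<Rightarrow> complex \<Rightarrow> complex"
    and G :: "complex \<Rightarrow> chain"
    and U T Wp Tp Tm Wm :: "complex \<Rightarrow> complex poly"
    and p :: "complex \<Rightarrow> nat \<Rightarrow> complex poly"
    and \<gamma> a :: "complex \<Rightarrow> nat \<Rightarrow> complex"
    and f g :: "complex \<Rightarrow> complex"
  assumes q: "q \<noteq> 0" "norm q < 1"
    and b: "b1 \<noteq> 0" "b2 \<noteq> 0" "b3 \<noteq> 0" "b4 \<noteq> 0" "b6 \<noteq> 0" "b1 * b2 * b3 * b4 = 1"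
    and t: "t \<noteq> 0"
    and w: "w = weight q b1 b2 b3 b4 b6"
    and terminals: "\<And>s e. s \<in> {t, q * t} \<Longrightarrow> e \<in> terminals (G s) \<Longrightarrow>
          boundary_point q b1 b2 b3 b4 b6 s e"
    and D_eq: "\<And>s x. s \<in> {t, q * t} \<Longrightarrow> x \<notin> support q (G s) \<Longrightarrow> q * x \<notin> support q (G s) \<Longrightarrow>
          D_minus b2 b3 b6 s x * stieltjes q (w s) (G s) (q * x) =
          D_plus b1 b4 b6 s x * stieltjes q (w s) (G s) x + (q - 1) * x * poly (U s) x"
    and E_eq: "\<And>x. x \<notin> support q (G t) \<Longrightarrow> x \<notin> support q (G (q * t)) \<Longrightarrow>
          E_minus q b6 t x * stieltjes q (w (q * t)) (G (q * t)) x =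
          E_plus q b6 t x * stieltjes q (w t) (G t) x + (q - 1) * t * poly (T t) x"
    and orth: "\<And>s. s \<in> {t, q * t} \<Longrightarrow> orthonormal_polys q (w s) (G s) (p s) (\<gamma> s)"
    and a_def: "\<And>s k. s \<in> {t, q * t} \<Longrightarrow> k \<ge> 1 \<Longrightarrow> a s k = \<gamma> s (k - 1) / \<gamma> s k"
    and a0: "\<And>s. s \<in> {t, q * t} \<Longrightarrow> a s 0 \<noteq> 0"
    and spectral: "\<And>s x. s \<in> {t, q * t} \<Longrightarrow>
          x \<notin> support q (G s) \<Longrightarrow> q * x \<notin> support q (G s) \<Longrightarrow>
          (\<forall>z\<in>{x, q * x}. weight_num q b2 b3 b6 s z \<noteq> 0 \<and> weight_den q b1 b4 b6 s z \<noteq> 0) \<Longrightarrow>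
          mat (D_plus b1 b4 b6 s x) ** Y_mat q (w s) (G s) (p s) (\<gamma> s) (a s 0) n (q * x) =
          eval_mat (vector [vector [Wp s, - Tp s], vector [Tm s, Wm s]]) x **
          Y_mat q (w s) (G s) (p s) (\<gamma> s) (a s 0) n x"
    and b5: "b5 = b1 * b4 * b6 * q ^ n" "\<And>r. r\<^sup>2 = q \<Longrightarrow> b5 \<noteq> 1 / r"
    and g_def: "\<And>s. s \<in> {t, q * t} \<Longrightarrow> \<exists>L. Tp s = [:0, 1:] * L \<and> poly L (g s) = 0"
    and f_def: "\<And>s. s \<in> {t, q * t} \<Longrightarrow>
          poly (Wp s) (g s) =
          - (1 / s) * (g s - b6 * s) * (b6 * g s - s) * (f (s / q) * g s - 1)"
    and g_ne: "\<And>s. s \<in> {t, q * t} \<Longrightarrow> g s \<noteq> 0 \<and> g s \<noteq> b6 * s \<and> g s \<noteq> s / b6"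
    and a_n: "\<And>s. s \<in> {t, q * t} \<Longrightarrow> a s n \<noteq> 0"
  shows "(g t * f (t / q) - 1) * (g t * f t - 1) =
    t\<^sup>2 * ((g t - 1 / b1) * (g t - 1 / b2) * (g t - 1 / b3) * (g t - 1 / b4)) /
    ((g t - b6 * t) * (g t - t / b6))"
proof -

  \<comment> \<open>Notation, Stieltjes decompositions and Casoratians at both times\<close>
  define u where "u = (\<lambda>s. second_kind q (w s) (G s) (p s n))"
  define pm where "pm = (\<lambda>s. if n = 0 then 0 else p s (n - 1))"
  \<comment> \<open>In the branch \<open>n = 0\<close> the factor \<open>a s n\<close> is the
    \<open>a s 0\<close> of \<open>Y_mat\<close>; the form with \<open>n\<close> allows one
    Casoratian formula for all \<open>n\<close>.\<close>
  define v where "v = (\<lambda>s x. if n = 0 then 1 / (a s n * \<gamma> s 0) else second_kind q (w s) (G s) (p s (n - 1)) x)"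
  define \<phi> where "\<phi> = (\<lambda>s. stieltjes q (w s) (G s))"
  define t' where "t' = q * t"
  define Dp where "Dp = D_plus b1 b4 b6"
  define Dm where "Dm = D_minus b2 b3 b6"
  define Ep where "Ep = E_plus q b6 t"
  define Em where "Em = E_minus q b6 t"
  have tt: "t \<in> {t, q * t}" and tt': "t' \<in> {t, q * t}" unfolding t'_def by auto
  have s_ne: "s \<noteq> 0" if "s \<in> {t, q * t}" for s using that t q by auto
  have qs: "qsummable q (G s) (w s)" for s
    unfolding qsummable_def w using summable_weight[OF q(2)] by blast
  have deg: "degree (p s m) = m" "coeff (p s m) m = \<gamma> s m" "\<gamma> s m \<noteq> 0"
    if "s \<in> {t, q * t}" for s m
    using orth[OF that] unfolding orthonormal_polys_def by metis+
  have a_eq: "a s n = \<gamma> s (n - 1) / \<gamma> s n" if "s \<in> {t, q * t}" "n \<ge> 1" for s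
    using a_def[OF that] .
  have v_alt: "v s = (\<lambda>x. if n = 0 then 1 / (a s n * \<gamma> s 0) else second_kind q (w s) (G s) (p s (n - 1)) x)" for s
    unfolding v_def ..
  have pm_alt: "pm s = (if n = 0 then 0 else p s (n - 1))" for s
    unfolding pm_def ..
  have "\<exists>r. \<forall>x. x \<notin> support q (G s) \<longrightarrow> u s x = poly (p s n) x * \<phi> s x + poly r x" for s
    using second_kind_decomp[OF q(2) qs] unfolding u_def \<phi>_def by metis
  then obtain r where r: "\<And>s x. x \<notin> support q (G s) \<Longrightarrow> u s x = poly (p s n) x * \<phi> s x + poly (r s) x"
    by metis
  have "\<exists>r. \<forall>x. x \<notin> support q (G s) \<longrightarrow> v s x = poly (pm s) x * \<phi> s x + poly r x"
    if "s \<in> {t, q * t}" for s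
    using second_kind_prev_decomp[OF q(2) qs orth[OF that] a_n[OF that] a_eq[OF that] pm_alt v_alt]
    unfolding \<phi>_def .
  then obtain rm where rm: "\<And>s x. s \<in> {t, q * t} \<Longrightarrow> x \<notin> support q (G s) \<Longrightarrow>
      v s x = poly (pm s) x * \<phi> s x + poly (rm s) x"
    by metis
  have cas: "poly (p s n) x * v s x - poly (pm s) x * u s x = 1 / a s n"
    if "s \<in> {t, q * t}" "x \<notin> support q (G s)" for s x
    using casoratian_prev[OF q(2) qs orth[OF that(1)] a_n[OF that(1)] a_eq[OF that(1)] pm_alt v_alt that(2)]
    unfolding u_def .

  \<comment> \<open>The set of regular points\<close>
  define S where "S = {x. \<forall>s\<in>{t, q * t}. \<forall>z\<in>{x, q * x}. z \<notin> support q (G s) \<and>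
      weight_num q b2 b3 b6 s z \<noteq> 0 \<and> weight_den q b1 b4 b6 s z \<noteq> 0}"
  \<comment> \<open>\<open>S\<close> asks for regularity at \<open>x\<close> and at
    \<open>q * x\<close>, for both times, so that all shift relations hold on it at once; its
    complement is covered by \<open>bad\<close> and the preimage of \<open>bad\<close> under
    multiplication by \<open>q\<close>.\<close>
  define bad where "bad = (\<Union>s\<in>{t, q * t}. support q (G s) \<union>
      {x. weight_num q b2 b3 b6 s x = 0} \<union> {x. weight_den q b1 b4 b6 s x = 0})"
  have "countable bad"
    unfolding bad_def
    by (simp add: countable_support countable_weight_num_zeros[OF q(2)] countable_weight_den_zeros[OF q(2)])
  moreover have "- S \<subseteq> bad \<union> (\<lambda>y. y / q) ` bad"
  proof
    fix x assume "x \<in> - S"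
    then obtain z where "z \<in> {x, q * x}" "z \<in> bad"
      unfolding S_def bad_def by auto
    moreover have "x = (q * x) / q" using q(1) by simp
    ultimately show "x \<in> bad \<union> (\<lambda>y. y / q) ` bad" by blast
  qed
  ultimately have S: "countable (- S)"
    by (meson countable_Un countable_image countable_subset)
  have S_supp: "x \<notin> support q (G s)" "q * x \<notin> support q (G s)" if "x \<in> S" "s \<in> {t, q * t}" for x s
    using that unfolding S_def by auto
  have S_ne: "x \<noteq> 0" if "x \<in> S" for x
    using S_supp(1)[OF that tt] unfolding support_def by auto
  have Dp_ne: "Dp s x \<noteq> 0" if "x \<in> S" "s \<in> {t, q * t}" for x s
    unfolding Dp_def using that b(5) q(2) s_ne[OF that(2)]
    by (intro weight_den_nonzero_imp_D_plus) (auto simp: S_def)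
  have Dm_ne: "Dm s x \<noteq> 0" if "x \<in> S" "s \<in> {t, q * t}" for x s
    unfolding Dm_def using that b(5) q(2) s_ne[OF that(2)]
    by (intro weight_num_nonzero_imp_D_minus) (auto simp: S_def)

  \<comment> \<open>Scalar spectral relations and the determinant identity\<close>
  have spec: "Dp s x * poly (p s n) (q * x) = poly (Wp s) x * poly (p s n) x - poly (Tp s) x * poly (pm s) x"
    "Dp s x * poly (pm s) (q * x) = poly (Tm s) x * poly (p s n) x + poly (Wm s) x * poly (pm s) x"
    "Dm s x * u s (q * x) = poly (Wp s) x * u s x - poly (Tp s) x * v s x"
    "Dm s x * v s (q * x) = poly (Tm s) x * u s x + poly (Wm s) x * v s x"
    if x: "x \<in> S" and s: "s \<in> {t, q * t}" for x s
  proof -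
    have nz: "\<forall>z\<in>{x, q * x}. weight_num q b2 b3 b6 s z \<noteq> 0 \<and> weight_den q b1 b4 b6 s z \<noteq> 0"
      using x s unfolding S_def by blast
    have Y: "Y_mat q (w s) (G s) (p s) (\<gamma> s) (a s 0) n z =
        vector [vector [poly (p s n) z, u s z / w s z], vector [poly (pm s) z, v s z / w s z]]" for z
      unfolding Y_mat_def u_def v_def pm_def by simp
    note spectral[OF s S_supp[OF x s] nz, unfolded Y]
    note e = spectral_entries[OF this]
    show "Dp s x * poly (p s n) (q * x) = poly (Wp s) x * poly (p s n) x - poly (Tp s) x * poly (pm s) x"
      "Dp s x * poly (pm s) (q * x) = poly (Tm s) x * poly (p s n) x + poly (Wm s) x * poly (pm s) x"
      using e(1,3) unfolding Dp_def by simp_all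
    have "w s z \<noteq> 0" if "z \<in> {x, q * x}" for z
      using nz that unfolding w weight_def by auto
    then have wz: "w s x \<noteq> 0" "w s (q * x) \<noteq> 0" by auto
    have "Dm s x * w s (q * x) = Dp s x * w s x"
      unfolding Dm_def Dp_def w using nz b(5) q(2) s_ne[OF s] by (intro weight_pearson) auto
    note col = spectral_second_column[OF this Dp_ne[OF x s] wz]
    show "Dm s x * u s (q * x) = poly (Wp s) x * u s x - poly (Tp s) x * v s x"
      using col[of "u s (q * x)" "poly (Wp s) x" "u s x" "- poly (Tp s) x" "v s x"] e(2)
      unfolding Dp_def by simp
    show "Dm s x * v s (q * x) = poly (Tm s) x * u s x + poly (Wm s) x * v s x"
      using col[of "v s (q * x)" "poly (Tm s) x" "u s x" "poly (Wm s) x" "v s x"] e(4)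
      unfolding Dp_def by simp
  qed
  have det_S: "poly (Wp s) x * poly (Wm s) x + poly (Tp s) x * poly (Tm s) x = Dp s x * Dm s x"
    if x: "x \<in> S" and s: "s \<in> {t, q * t}" for x s
    by (rule spectral_det[OF _ cas[OF s S_supp(1)[OF x s]] cas[OF s S_supp(2)[OF x s]]
        spec(1)[OF x s] spec(2)[OF x s] spec(3)[OF x s] spec(4)[OF x s]])
      (use a_n[OF s] in simp)
  define DpP where "DpP = (\<lambda>s. smult b6 ([:1, - b1:] * [:1, - b4:] * [:s, - b6:]))"
  define DmP where "DmP = (\<lambda>s. [:1, - b2:] * [:1, - b3:] * [:b6 * s, - 1:])"
  define EpP where "EpP = [:q * t, - 1 / b6:]"
  define EmP where "EmP = [:q * t, - b6:]"
  have DpP: "poly (DpP s) x = Dp s x" for s x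
    unfolding DpP_def Dp_def D_plus_def by (simp add: algebra_simps)
  have DmP: "poly (DmP s) x = Dm s x" for s x
    unfolding DmP_def Dm_def D_minus_def by (simp add: algebra_simps)
  have EpP: "poly EpP x = Ep x" for x
    unfolding EpP_def Ep_def E_plus_def using b(5) by (simp add: field_simps)
  have EmP: "poly EmP x = Em x" for x
    unfolding EmP_def Em_def E_minus_def by (simp add: algebra_simps)
  \<comment> \<open>The identity must hold at \<open>g t\<close>, which may lie outside
    \<open>S\<close>; hence the passage to polynomials.\<close>
  have "Wp t * Wm t + Tp t * Tm t = DpP t * DmP t"
    by (rule poly_eqI_cocountable[OF S]) (simp add: det_S[OF _ tt] DpP DmP)
  then have det: "poly (Wp t) x * poly (Wm t) x + poly (Tp t) x * poly (Tm t) x = Dp t x * Dm t x" for x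
    by (metis DmP DpP poly_add poly_mult)

  \<comment> \<open>Polynomial entries of the matrix of the \<open>t\<close>-shift\<close>
  define \<alpha> where "\<alpha> = a t n"
  have \<alpha>: "\<alpha> \<noteq> 0" using a_n[OF tt] unfolding \<alpha>_def .
  have E: "Em x * \<phi> t' x - Ep x * \<phi> t x = (q - 1) * t * poly (T t) x"
    if "x \<notin> support q (G t)" "x \<notin> support q (G t')" for x
    using E_eq[of x] that unfolding Em_def Ep_def \<phi>_def t'_def by simp
  \<comment> \<open>\<open>E\<^sub>+ Y(qt) Y(t)\<^sup>-\<^sup>1\<close> has entries \<open>RR\<close>, \<open>- PP\<close>, \<open>SS\<close> in positions
    (1,1), (1,2), (2,2); \<open>E_eq\<close> makes them polynomial.\<close>
  define PP where "PP = smult \<alpha> (smult ((1 - q) * t) (p t' n * p t n * T t) +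
      EpP * p t' n * r t - EmP * r t' * p t n)"
  define RR where "RR = smult \<alpha> (smult ((1 - q) * t) (p t' n * pm t * T t) +
      EpP * p t' n * rm t - EmP * r t' * pm t)"
  define SS where "SS = smult \<alpha> (smult ((q - 1) * t) (p t n * pm t' * T t) +
      EmP * rm t' * p t n - EpP * pm t' * r t)"
  have PP: "poly PP x = \<alpha> * (Ep x * poly (p t' n) x * u t x - Em x * u t' x * poly (p t n) x)"
    and RR: "poly RR x = \<alpha> * (Ep x * poly (p t' n) x * v t x - Em x * u t' x * poly (pm t) x)"
    and SS: "poly SS x = \<alpha> * (Em x * v t' x * poly (p t n) x - Ep x * poly (pm t') x * u t x)"
    if x: "x \<notin> support q (G t)" "x \<notin> support q (G t')" for x
  proof -
    note dec = r[OF x(1)] r[OF x(2)] rm[OF tt x(1)] rm[OF tt' x(2)]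
    \<comment> \<open>After the decompositions are inserted, the Stieltjes functions occur only in
      the combination on the left of \<open>E\<close>, with a polynomial factor
      \<open>y\<close>.\<close>
    have T: "(1 - q) * t * (y * poly (T t) x) = - (y * (Em x * \<phi> t' x - Ep x * \<phi> t x))"
      and T': "(q - 1) * t * (y * poly (T t) x) = y * (Em x * \<phi> t' x - Ep x * \<phi> t x)" for y
      unfolding E[OF x] by (simp_all add: algebra_simps)
    show "poly PP x = \<alpha> * (Ep x * poly (p t' n) x * u t x - Em x * u t' x * poly (p t n) x)"
      unfolding PP_def dec poly_smult poly_add poly_diff poly_mult T EpP EmP
      by (simp add: algebra_simps)
    show "poly RR x = \<alpha> * (Ep x * poly (p t' n) x * v t x - Em x * u t' x * poly (pm t) x)"
      unfolding RR_def dec poly_smult poly_add poly_diff poly_mult T EpP EmP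
      by (simp add: algebra_simps)
    show "poly SS x = \<alpha> * (Em x * v t' x * poly (p t n) x - Ep x * poly (pm t') x * u t x)"
      unfolding SS_def dec poly_smult poly_add poly_diff poly_mult T' EpP EmP
      by (simp add: algebra_simps)
  qed
  \<comment> \<open>Up to constants, \<open>Ep (q * x)\<close> supplies to \<open>Dp t x\<close> the
    linear factor that \<open>Dm t x\<close> has, and \<open>Em (q * x)\<close> supplies to
    \<open>Dm t x\<close> the one that \<open>Dp t x\<close> has. So both products share a quadratic
    factor; the same happens below at time \<open>t'\<close> with argument \<open>x\<close>.\<close>
  have fact_t: "Ep (q * x) * Dp t x = q * ((t - b6 * x) * (b6 * t - x)) * ((1 - b1 * x) * (1 - b4 * x))"
    "Em (q * x) * Dm t x = q * ((t - b6 * x) * (b6 * t - x)) * ((1 - b2 * x) * (1 - b3 * x))" for x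
  proof -
    have "Ep (q * x) * b6 = q * (b6 * t - x)"
      unfolding Ep_def E_plus_def using b(5) by (simp, simp add: algebra_simps)
    moreover have "Ep (q * x) * Dp t x = Ep (q * x) * b6 * ((1 - b1 * x) * (1 - b4 * x) * (t - b6 * x))"
      unfolding Dp_def D_plus_def by (simp only: mult.assoc)
    ultimately show "Ep (q * x) * Dp t x = q * ((t - b6 * x) * (b6 * t - x)) * ((1 - b1 * x) * (1 - b4 * x))"
      by (simp only: mult_ac)
    show "Em (q * x) * Dm t x = q * ((t - b6 * x) * (b6 * t - x)) * ((1 - b2 * x) * (1 - b3 * x))"
      unfolding Em_def Dm_def E_minus_def D_minus_def by algebra
  qed
  have fact_t': "Ep x * Dp t' x = (t' - b6 * x) * (b6 * t' - x) * ((1 - b1 * x) * (1 - b4 * x))"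
    "Em x * Dm t' x = (t' - b6 * x) * (b6 * t' - x) * ((1 - b2 * x) * (1 - b3 * x))" for x
  proof -
    have "Ep x * b6 = b6 * t' - x"
      unfolding Ep_def E_plus_def t'_def using b(5) by (simp add: mult.assoc)
    moreover have "Ep x * Dp t' x = Ep x * b6 * ((1 - b1 * x) * (1 - b4 * x) * (t' - b6 * x))"
      unfolding Dp_def D_plus_def by (simp only: mult.assoc)
    ultimately show "Ep x * Dp t' x = (t' - b6 * x) * (b6 * t' - x) * ((1 - b1 * x) * (1 - b4 * x))"
      by (simp only: mult_ac)
    show "Em x * Dm t' x = (t' - b6 * x) * (b6 * t' - x) * ((1 - b2 * x) * (1 - b3 * x))"
      unfolding Em_def Dm_def E_minus_def D_minus_def t'_def by algebra
  qed

  \<comment> \<open>Divisibility by the common quadratic factor\<close>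
  define h where "h = (\<lambda>x. (1 - b1 * x) * (1 - b4 * x) * \<phi> t x - (1 - b2 * x) * (1 - b3 * x) * \<phi> t' (q * x))"
  define Q where "Q = [:0, q:]"
  \<comment> \<open>\<open>V\<close> results from eliminating \<open>\<phi> t (q * x)\<close>
    between \<open>D_eq\<close> at \<open>x\<close> and \<open>E_eq\<close> at \<open>q * x\<close>;
    \<open>h\<close> is what remains once the quadratic factor is split off. Composition with
    \<open>Q\<close> is the shift to \<open>q * x\<close>.\<close>
  define V where "V = smult (1 - q) ([:0, 1:] * U t * pcompose EpP Q + smult t (DmP t * pcompose (T t) Q))"
  have V: "poly V x = q * ((t - b6 * x) * (b6 * t - x)) * h x" if x: "x \<in> S" for x
  proof -
    have eqU: "(q - 1) * x * poly (U t) x = Dm t x * \<phi> t (q * x) - Dp t x * \<phi> t x"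
      using D_eq[OF tt S_supp[OF x tt]] unfolding Dm_def Dp_def \<phi>_def by simp
    have eqT: "(q - 1) * t * poly (T t) (q * x) = Em (q * x) * \<phi> t' (q * x) - Ep (q * x) * \<phi> t (q * x)"
      using E[OF S_supp(2)[OF x tt] S_supp(2)[OF x tt']] by simp
    have V_eq: "poly V x = - (Ep (q * x) * ((q - 1) * x * poly (U t) x) + Dm t x * ((q - 1) * t * poly (T t) (q * x)))"
      unfolding V_def Q_def by (simp add: poly_pcompose EpP DmP algebra_simps)
    have "poly V x = Ep (q * x) * Dp t x * \<phi> t x - Em (q * x) * Dm t x * \<phi> t' (q * x)"
      unfolding V_eq eqU eqT by (simp add: algebra_simps)
    then show ?thesis unfolding fact_t h_def by (simp add: algebra_simps)
  qed
  have notin_S: "t / b6 \<notin> S" "b6 * t \<notin> S"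
    using Dp_ne[OF _ tt, of "t / b6"] Dm_ne[OF _ tt, of "b6 * t"] b(5)
    by (auto simp: Dp_def Dm_def D_plus_def D_minus_def)
  have w0: "w s (b6 * s) = 0" "w s (s / b6) = 0" if "s \<in> {t, q * t}" for s
    unfolding w using weight_eq_0_num[OF q(2) b(5) s_ne[OF that]]
      weight_eq_0_den[OF q(2) b(5) s_ne[OF that]] by auto
  have Bh: "Bfun h (at x within S)" if "x \<in> {t / b6, b6 * t}" for x
  proof -
    have ne: "x \<noteq> 0" "q * x \<noteq> 0" using that t b(5) q(1) by auto
    \<comment> \<open>Multiplication by \<open>q\<close> maps the two massless points of time
      \<open>t\<close> to those of time \<open>t'\<close>.\<close>
    have "w t x = 0" "w t' (q * x) = 0"
      using that w0[OF tt] w0[OF tt'] unfolding t'_def by (auto simp: mult_ac)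
    then have B\<phi>: "Bfun (\<lambda>x. \<phi> t (1 * x)) (at x within S)" "Bfun (\<lambda>x. \<phi> t' (q * x)) (at x within S)"
      unfolding \<phi>_def using ne by (intro Bfun_stieltjes q(2) qs; simp)+
    have Blin: "Bfun (\<lambda>x. (1 - c * x) * (1 - d * x)) (at x within S)" for c d
      by (rule Bfun_tendsto[where L = "(1 - c * x) * (1 - d * x)"]) (intro tendsto_intros)
    show ?thesis
      unfolding h_def using Bfun_diff[OF Bfun_mult[OF Blin B\<phi>(1)] Bfun_mult[OF Blin B\<phi>(2)]] by simp
  qed
  have "poly (smult (1 / (q * b6)) V) x = (x - t / b6) * (x - b6 * t) * h x" if "x \<in> S" for x
    unfolding poly_smult V[OF that] using q(1) b(5) by (simp add: field_simps)
  then obtain H where H: "\<And>x. x \<in> S \<Longrightarrow> poly H x = h x"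
    using poly_quotient_of_bounded[OF S notin_S] Bh by (metis insertCI)
  have "V = smult q ([:t, - b6:] * [:b6 * t, - 1:] * H)"
    by (rule poly_eqI_cocountable[OF S]) (simp add: V H algebra_simps)
  \<comment> \<open>The point \<open>0\<close> belongs to the support, so \<open>h\<close> gives no
    access to \<open>H\<close> there. Computing \<open>V\<close> at \<open>0\<close> in two ways
    does: the \<open>U\<close> term carries a factor \<open>x\<close> and drops out.\<close>
  then have "poly V 0 = q * (t * (b6 * t)) * poly H 0"
    by simp
  moreover have "poly V 0 = (1 - q) * (t * (b6 * t)) * poly (T t) 0"
    unfolding V_def Q_def by (simp add: poly_pcompose DmP Dm_def D_minus_def)
  ultimately have H0: "q * poly H 0 = (1 - q) * poly (T t) 0"
    using t b(5) by simp

  \<comment> \<open>The common factor of the (1,2) entries of the two sides of the compatibility relation.\<close>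
  define LL where "LL = smult \<alpha> (pcompose (p t' n) Q * p t n * H +
    [:1, - b1:] * [:1, - b4:] * pcompose (p t' n) Q * r t -
    [:1, - b2:] * [:1, - b3:] * pcompose (r t') Q * p t n)"
  have LL: "poly LL x = \<alpha> * ((1 - b1 * x) * (1 - b4 * x) * poly (p t' n) (q * x) * u t x -
      (1 - b2 * x) * (1 - b3 * x) * u t' (q * x) * poly (p t n) x)" if x: "x \<in> S" for x
    unfolding LL_def r[OF S_supp(1)[OF x tt]] r[OF S_supp(2)[OF x tt']] Q_def
    by (simp add: poly_pcompose H[OF x] h_def algebra_simps)
  \<comment> \<open>\<open>EpP\<close> and \<open>EmP\<close> both have the value
    \<open>q * t\<close> at \<open>0\<close>, and \<open>H0\<close> matches the remaining terms in
    \<open>H\<close> and \<open>T\<close>.\<close>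
  have LL0: "q * t * poly LL 0 = poly PP 0"
  proof -
    have "q * t * poly LL 0 = \<alpha> * (t * (poly (p t' n) 0 * poly (p t n) 0) * (q * poly H 0) +
        q * t * (poly (p t' n) 0 * poly (r t) 0 - poly (r t') 0 * poly (p t n) 0))"
      unfolding LL_def Q_def by (simp add: poly_pcompose algebra_simps)
    also have "\<dots> = poly PP 0"
      unfolding H0 PP_def by (simp add: EpP_def EmP_def algebra_simps)
    finally show ?thesis .
  qed

  \<comment> \<open>Asymptotics at infinity\<close>
  define F where "F = inf at_infinity (principal S)"
  \<comment> \<open>\<open>F\<close> is infinity approached through \<open>S\<close>: identities
    known only on \<open>S\<close> hold eventually along it, and limits stay unique.\<close>
  have F: "F \<noteq> bot" "F \<le> at_infinity"
    unfolding F_def using at_infinity_cocountable_neq_bot[OF S] by auto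
  have ev_S: "\<forall>\<^sub>F x in F. x \<in> S"
    unfolding F_def by (simp add: eventually_inf_principal)
  have lim_poly: "((\<lambda>x. poly P x / x ^ m) \<longlongrightarrow> coeff P m) F" if "degree P \<le> m" for P m
    by (intro tendsto_mono[OF F(2)] poly_tendsto_coeff that)
  have lim_p: "((\<lambda>x. poly (p s n) x / x ^ n) \<longlongrightarrow> \<gamma> s n) F" if "s \<in> {t, q * t}" for s
    using lim_poly[of "p s n" n] deg[OF that, of n] by simp
  have lim_u_inf: "((\<lambda>x. x ^ Suc n * u s x) \<longlongrightarrow> 1 / \<gamma> s n) at_infinity" if "s \<in> {t, q * t}" for s
    using second_kind_orthonormal_leading[OF q(2) qs orth[OF that]] unfolding u_def .
  have lim_u: "((\<lambda>x. x ^ Suc n * u s x) \<longlongrightarrow> 1 / \<gamma> s n) F" if "s \<in> {t, q * t}" for s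
    by (rule tendsto_mono[OF F(2) lim_u_inf[OF that]])
  have lim_v: "((\<lambda>x. x ^ n * v s x) \<longlongrightarrow> 1 / (a s n * \<gamma> s n)) F" if "s \<in> {t, q * t}" for s
    by (rule tendsto_mono[OF F(2) second_kind_prev_leading[OF q(2) qs orth[OF that] a_n[OF that]
      a_eq[OF that] pm_alt v_alt]])
  have lim_pm: "((\<lambda>x. poly (pm s) x / x ^ n) \<longlongrightarrow> 0) F" if "s \<in> {t, q * t}" for s
    by (rule tendsto_mono[OF F(2) poly_prev_leading[OF q(2) qs orth[OF that] a_n[OF that]
      a_eq[OF that] pm_alt v_alt]])
  have lim_inv: "((\<lambda>x::complex. inverse x) \<longlongrightarrow> 0) F"
    by (intro tendsto_mono[OF F(2)] tendsto_inverse_0)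
  have "filterlim (\<lambda>x. q * x) at_infinity at_infinity"
    by (intro tendsto_mult_filterlim_at_infinity[OF tendsto_const q(1)] filterlim_ident)
  then have at_q: "filterlim (\<lambda>x. q * x) at_infinity F"
    using F(2) by (rule filterlim_mono[OF _ order_refl])
  have lim_pq: "((\<lambda>x. poly (p s n) (q * x) / x ^ n) \<longlongrightarrow> \<gamma> s n * q ^ n) F" if "s \<in> {t, q * t}" for s
  proof -
    have "((\<lambda>x. poly (p s n) (q * x) / (q * x) ^ n * q ^ n) \<longlongrightarrow> \<gamma> s n * q ^ n) F"
      by (intro tendsto_intros filterlim_compose[OF poly_tendsto_coeff[of "p s n" n] at_q, unfolded deg(2)[OF that]])
        (simp add: deg(1)[OF that])
    then show ?thesis using q(1) by (simp add: power_mult_distrib)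
  qed
  have lim_uq: "((\<lambda>x. x ^ Suc n * u s (q * x)) \<longlongrightarrow> 1 / \<gamma> s n / q ^ Suc n) F" if "s \<in> {t, q * t}" for s
  proof -
    have "((\<lambda>x. (q * x) ^ Suc n * u s (q * x) / q ^ Suc n) \<longlongrightarrow> 1 / \<gamma> s n / q ^ Suc n) F"
      using q(1) by (intro tendsto_divide tendsto_const filterlim_compose[OF lim_u_inf[OF that] at_q]) simp
    then show ?thesis using q(1) by (simp add: power_mult_distrib mult.assoc)
  qed
  have lim_Ep: "((\<lambda>x. Ep x / x ^ 1) \<longlongrightarrow> - 1 / b6) F" and lim_Em: "((\<lambda>x. Em x / x ^ 1) \<longlongrightarrow> - b6) F"
    using lim_poly[of EpP 1] lim_poly[of EmP 1] unfolding EpP EmP by (simp_all add: EpP_def EmP_def)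
  have lim_lin2: "((\<lambda>x. ((1 - c * x) * (1 - d * x)) / x ^ 2) \<longlongrightarrow> c * d) F" for c d
    using lim_poly[of "[:1, - c:] * [:1, - d:]" 2]
    by (simp add: numeral_2_eq_2 algebra_simps)

  \<comment> \<open>Degrees of the \<open>t\<close>-shift entries and of the common factor\<close>
  have "((\<lambda>x. \<alpha> * ((Ep x / x ^ 1) * (poly (p t' n) x / x ^ n) * (x ^ Suc n * u t x) -
      (Em x / x ^ 1) * (x ^ Suc n * u t' x) * (poly (p t n) x / x ^ n))) \<longlongrightarrow>
      \<alpha> * ((- 1 / b6) * \<gamma> t' n * (1 / \<gamma> t n) - (- b6) * (1 / \<gamma> t' n) * \<gamma> t n)) F"
    by (intro tendsto_intros lim_Ep lim_Em lim_p lim_u tt tt')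
  moreover have "\<forall>\<^sub>F x in F. \<alpha> * ((Ep x / x ^ 1) * (poly (p t' n) x / x ^ n) * (x ^ Suc n * u t x) -
      (Em x / x ^ 1) * (x ^ Suc n * u t' x) * (poly (p t n) x / x ^ n)) = poly PP x / x ^ 0"
    using ev_S
  proof eventually_elim
    case (elim x)
    show ?case
      unfolding PP[OF S_supp(1)[OF elim tt] S_supp(1)[OF elim tt']] using S_ne[OF elim] by simp
  qed
  ultimately have "((\<lambda>x. poly PP x / x ^ 0) \<longlongrightarrow>
      \<alpha> * ((- 1 / b6) * \<gamma> t' n * (1 / \<gamma> t n) - (- b6) * (1 / \<gamma> t' n) * \<gamma> t n)) F"
    by (rule Lim_transform_eventually)
  from poly_degree_le_of_tendsto(1)[OF F this] have PP_const: "poly PP x = poly PP 0" for x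
    using poly_degree_0[of PP] by simp

  \<comment> \<open>Only the first product survives in the limit: the second tends to
    \<open>0\<close> through \<open>pm\<close> and through \<open>inverse x\<close>. The surviving
    limit is a nonzero coefficient of \<open>RR\<close>.\<close>
  have "((\<lambda>x. \<alpha> * ((Ep x / x ^ 1) * (poly (p t' n) x / x ^ n) * (x ^ n * v t x) -
      (Em x / x ^ 1) * (x ^ Suc n * u t' x) * (poly (pm t) x / x ^ n) * inverse x)) \<longlongrightarrow>
      \<alpha> * ((- 1 / b6) * \<gamma> t' n * (1 / (a t n * \<gamma> t n)) - (- b6) * (1 / \<gamma> t' n) * 0 * 0)) F"
    by (intro tendsto_intros lim_Ep lim_Em lim_p lim_u lim_v lim_pm lim_inv tt tt')
  moreover have "\<forall>\<^sub>F x in F. \<alpha> * ((Ep x / x ^ 1) * (poly (p t' n) x / x ^ n) * (x ^ n * v t x) -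
      (Em x / x ^ 1) * (x ^ Suc n * u t' x) * (poly (pm t) x / x ^ n) * inverse x) = poly RR x / x ^ 1"
    using ev_S
  proof eventually_elim
    case (elim x)
    show ?case
      unfolding RR[OF S_supp(1)[OF elim tt] S_supp(1)[OF elim tt']] using S_ne[OF elim]
      by (simp add: field_simps)
  qed
  ultimately have "((\<lambda>x. poly RR x / x ^ 1) \<longlongrightarrow>
      \<alpha> * ((- 1 / b6) * \<gamma> t' n * (1 / (a t n * \<gamma> t n)) - (- b6) * (1 / \<gamma> t' n) * 0 * 0)) F"
    by (rule Lim_transform_eventually)
  from poly_degree_le_of_tendsto(2)[OF F this]
  have "coeff RR 1 \<noteq> 0"
    using deg(3)[OF tt] deg(3)[OF tt'] \<alpha> b(5) a_n[OF tt] by simp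
  then have RR_ne: "RR \<noteq> 0" by auto

  \<comment> \<open>A quadratic factor, a polynomial of degree \<open>n\<close> and a function of
    order \<open>x\<close> to the power \<open>-(n + 1)\<close> leave linear growth.\<close>
  have "((\<lambda>x. \<alpha> * (((1 - b1 * x) * (1 - b4 * x)) / x ^ 2 * (poly (p t' n) (q * x) / x ^ n) * (x ^ Suc n * u t x) -
      ((1 - b2 * x) * (1 - b3 * x)) / x ^ 2 * (x ^ Suc n * u t' (q * x)) * (poly (p t n) x / x ^ n))) \<longlongrightarrow>
      \<alpha> * (b1 * b4 * (\<gamma> t' n * q ^ n) * (1 / \<gamma> t n) - b2 * b3 * (1 / \<gamma> t' n / q ^ Suc n) * \<gamma> t n)) F"
    by (intro tendsto_intros lim_lin2 lim_p lim_u lim_pq lim_uq tt tt')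
  moreover have "\<forall>\<^sub>F x in F. \<alpha> * (((1 - b1 * x) * (1 - b4 * x)) / x ^ 2 * (poly (p t' n) (q * x) / x ^ n) * (x ^ Suc n * u t x) -
      ((1 - b2 * x) * (1 - b3 * x)) / x ^ 2 * (x ^ Suc n * u t' (q * x)) * (poly (p t n) x / x ^ n)) = poly LL x / x ^ 1"
    using ev_S
  proof eventually_elim
    case (elim x)
    have e: "y / x ^ 2 * (c / x ^ n) * (x ^ Suc n * d) = y * c * d / x ^ 1"
      "y / x ^ 2 * (x ^ Suc n * d) * (c / x ^ n) = y * d * c / x ^ 1" for y c d
      using S_ne[OF elim] by (simp_all add: field_simps power2_eq_square)
    show ?case
      unfolding LL[OF elim] e by (simp only: diff_divide_distrib times_divide_eq_right[symmetric])
  qed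
  ultimately have "((\<lambda>x. poly LL x / x ^ 1) \<longlongrightarrow>
      \<alpha> * (b1 * b4 * (\<gamma> t' n * q ^ n) * (1 / \<gamma> t n) - b2 * b3 * (1 / \<gamma> t' n / q ^ Suc n) * \<gamma> t n)) F"
    by (rule Lim_transform_eventually)
  from poly_degree_le_of_tendsto(1)[OF F this]
  have "degree LL \<le> 1" .
  then have LL_lin: "poly LL x = poly LL 0 + coeff LL 1 * x" for x
    by (rule poly_degree_le_1)

  \<comment> \<open>The leading coefficient of \<open>Tp t\<close>\<close>
  have Tp_eq: "poly (Tp t) x = \<alpha> * (Dp t x * poly (p t n) (q * x) * u t x - Dm t x * u t (q * x) * poly (p t n) x)"
    if x: "x \<in> S" for x
  proof -
    \<comment> \<open>Cramer's rule: eliminating \<open>Wp\<close> from the two relations of the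
      first row leaves \<open>Tp\<close> times the Casoratian.\<close>
    have "Dp t x * poly (p t n) (q * x) * u t x - Dm t x * u t (q * x) * poly (p t n) x =
        poly (Tp t) x * (poly (p t n) x * v t x - poly (pm t) x * u t x)"
      unfolding spec(1)[OF x tt] spec(3)[OF x tt] by (simp add: algebra_simps)
    then show ?thesis
      using cas[OF tt S_supp(1)[OF x tt]] \<alpha> unfolding \<alpha>_def by simp
  qed
  have "degree (DpP t) \<le> 3" "degree (DmP t) \<le> 3"
    by (simp_all add: DpP_def DmP_def)
  from this[THEN lim_poly] have lim_D: "((\<lambda>x. Dp t x / x ^ 3) \<longlongrightarrow> - (b1 * b4 * b6\<^sup>2)) F" "((\<lambda>x. Dm t x / x ^ 3) \<longlongrightarrow> - (b2 * b3)) F"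
    unfolding DpP DmP by (simp_all add: DpP_def DmP_def eval_nat_numeral mult_ac)
  have "((\<lambda>x. \<alpha> * (Dp t x / x ^ 3 * (poly (p t n) (q * x) / x ^ n) * (x ^ Suc n * u t x) -
      Dm t x / x ^ 3 * (x ^ Suc n * u t (q * x)) * (poly (p t n) x / x ^ n))) \<longlongrightarrow>
      \<alpha> * (- (b1 * b4 * b6\<^sup>2) * (\<gamma> t n * q ^ n) * (1 / \<gamma> t n) -
        - (b2 * b3) * (1 / \<gamma> t n / q ^ Suc n) * \<gamma> t n)) F"
    by (intro tendsto_intros lim_D lim_p lim_u lim_pq lim_uq tt)
  moreover have "\<forall>\<^sub>F x in F. \<alpha> * (Dp t x / x ^ 3 * (poly (p t n) (q * x) / x ^ n) * (x ^ Suc n * u t x) -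
      Dm t x / x ^ 3 * (x ^ Suc n * u t (q * x)) * (poly (p t n) x / x ^ n)) = poly (Tp t) x / x ^ 2"
    using ev_S
  proof eventually_elim
    case (elim x)
    have e: "y / x ^ 3 * (c / x ^ n) * (x ^ Suc n * d) = y * c * d / x ^ 2"
      "y / x ^ 3 * (x ^ Suc n * d) * (c / x ^ n) = y * d * c / x ^ 2" for y c d
      using S_ne[OF elim] by (simp_all add: field_simps eval_nat_numeral)
    show ?case
      unfolding Tp_eq[OF elim] e by (simp only: diff_divide_distrib times_divide_eq_right[symmetric])
  qed
  ultimately have "((\<lambda>x. poly (Tp t) x / x ^ 2) \<longlongrightarrow>
      \<alpha> * (- (b1 * b4 * b6\<^sup>2) * (\<gamma> t n * q ^ n) * (1 / \<gamma> t n) -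
        - (b2 * b3) * (1 / \<gamma> t n / q ^ Suc n) * \<gamma> t n)) F"
    by (rule Lim_transform_eventually)
  from poly_degree_le_of_tendsto(2)[OF F this]
  have "coeff (Tp t) 2 = \<alpha> * (b2 * b3 / q ^ Suc n - b1 * b4 * b6\<^sup>2 * q ^ n)"
    using deg(3)[OF tt, of n] by (simp add: algebra_simps)
  moreover have "b2 * b3 / q ^ Suc n \<noteq> b1 * b4 * b6\<^sup>2 * q ^ n"
  proof
    assume "b2 * b3 / q ^ Suc n = b1 * b4 * b6\<^sup>2 * q ^ n"
    then have "b2 * b3 = b1 * b4 * b6\<^sup>2 * q ^ n * q ^ Suc n"
      using q(1) by (simp add: field_simps)
    \<comment> \<open>The left side is \<open>1\<close> by the normalization of the parameters, so
      \<open>1 / b5\<close> would be a square root of \<open>q\<close>, which \<open>b5(2)\<close>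
      excludes.\<close>
    then have "b1 * b4 * (b2 * b3) = q * b5\<^sup>2"
      unfolding b5(1) by (simp add: power2_eq_square mult_ac)
    then have q_b5: "q * b5\<^sup>2 = 1"
      using b(6) by (simp add: mult_ac)
    then have "b5 \<noteq> 0" by auto
    with q_b5 have "(1 / b5)\<^sup>2 = q"
      by (simp add: power_divide field_simps)
    from b5(2)[OF this] show False by simp
  qed
  ultimately have "coeff (Tp t) 2 \<noteq> 0" using \<alpha> by simp
  then have Tp_ne: "Tp t \<noteq> 0" by auto

  \<comment> \<open>The two compatibility relations\<close>
  have factor: "\<alpha> * (k * c * (y * z) - k * d * (y' * z')) = k * (\<alpha> * (c * y * z - d * y' * z'))"
    for k c d y z y' z' :: complex
    by (simp add: algebra_simps)
  \<comment> \<open>Up to sign and prefactors this is the (1,2) entry of the passage from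
    \<open>(x, t)\<close> to \<open>(q * x, t')\<close>, with the \<open>x\<close>-shift first and
    the \<open>t\<close>-shift then taken at \<open>q * x\<close>.\<close>
  have eq1: "pcompose RR Q * Tp t + smult (poly PP 0) (Wm t) = smult q ([:t, - b6:] * [:b6 * t, - 1:] * LL)"
  proof (rule poly_eqI_cocountable[OF S])
    fix x assume x: "x \<in> S"
    note inv = spectral_inverse[OF Dp_ne[OF x tt] Dm_ne[OF x tt] det_S[OF x tt]
        spec(1)[OF x tt] spec(2)[OF x tt] spec(3)[OF x tt] spec(4)[OF x tt]]
    note supp = S_supp(2)[OF x tt] S_supp(2)[OF x tt']
    have "poly RR (q * x) * poly (Tp t) x + poly PP (q * x) * poly (Wm t) x =
        \<alpha> * (Ep (q * x) * poly (p t' n) (q * x) *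
          (u t (q * x) * poly (Wm t) x + v t (q * x) * poly (Tp t) x) -
        Em (q * x) * u t' (q * x) *
          (poly (p t n) (q * x) * poly (Wm t) x + poly (pm t) (q * x) * poly (Tp t) x))"
      unfolding RR[OF supp] PP[OF supp] by (simp add: algebra_simps)
    also have "\<dots> = \<alpha> * (Ep (q * x) * Dp t x * (poly (p t' n) (q * x) * u t x) -
        Em (q * x) * Dm t x * (u t' (q * x) * poly (p t n) x))"
      unfolding inv by (simp only: mult_ac)
    also have "\<dots> = q * ((t - b6 * x) * (b6 * t - x)) * poly LL x"
      unfolding fact_t LL[OF x] by (rule factor)
    finally show "poly (pcompose RR Q * Tp t + smult (poly PP 0) (Wm t)) x =
        poly (smult q ([:t, - b6:] * [:b6 * t, - 1:] * LL)) x"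
      unfolding PP_const[of "q * x"] Q_def by (simp add: poly_pcompose algebra_simps)
  qed
  have id1: "poly RR (q * x) * poly (Tp t) x + poly PP 0 * poly (Wm t) x =
      q * ((t - b6 * x) * (b6 * t - x)) * poly LL x" for x
    using arg_cong[OF eq1, of "\<lambda>P. poly P x"] by (simp add: poly_pcompose Q_def algebra_simps)
  \<comment> \<open>The same entry along the other path: first the \<open>t\<close>-shift at
    \<open>x\<close>, then the \<open>x\<close>-shift at time \<open>t'\<close>.\<close>
  have eq2: "smult (poly PP 0) (Wp t') + Tp t' * SS = [:t', - b6:] * [:b6 * t', - 1:] * LL"
  proof (rule poly_eqI_cocountable[OF S])
    fix x assume x: "x \<in> S"
    note supp = S_supp(1)[OF x tt] S_supp(1)[OF x tt']
    have "poly PP x * poly (Wp t') x + poly (Tp t') x * poly SS x =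
        \<alpha> * (Ep x * u t x * (poly (Wp t') x * poly (p t' n) x - poly (Tp t') x * poly (pm t') x) -
        Em x * poly (p t n) x * (poly (Wp t') x * u t' x - poly (Tp t') x * v t' x))"
      unfolding SS[OF supp] PP[OF supp] by (simp add: algebra_simps)
    also have "\<dots> = \<alpha> * (Ep x * Dp t' x * (poly (p t' n) (q * x) * u t x) -
        Em x * Dm t' x * (u t' (q * x) * poly (p t n) x))"
      unfolding spec(1)[OF x tt', symmetric] spec(3)[OF x tt', symmetric] by (simp only: mult_ac)
    also have "\<dots> = (t' - b6 * x) * (b6 * t' - x) * poly LL x"
      unfolding fact_t' LL[OF x] by (rule factor)
    finally show "poly (smult (poly PP 0) (Wp t') + Tp t' * SS) x =
        poly ([:t', - b6:] * [:b6 * t', - 1:] * LL) x"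
      unfolding PP_const[of x] by (simp add: algebra_simps)
  qed
  have id2: "poly PP 0 * poly (Wp t') x + poly (Tp t') x * poly SS x =
      (t' - b6 * x) * (b6 * t' - x) * poly LL x" for x
    using arg_cong[OF eq2, of "\<lambda>P. poly P x"] by (simp add: algebra_simps)

  \<comment> \<open>Evaluation at the zeros of \<open>Tp\<close>\<close>
  have Tg: "poly (Tp s) (g s) = 0" if "s \<in> {t, q * t}" for s
    using g_def[OF that] by auto
  have K_ne: "(s - b6 * g s) * (b6 * s - g s) \<noteq> 0" if "s \<in> {t, q * t}" for s
    using g_ne[OF that] b(5) by (auto simp: nonzero_eq_divide_eq mult.commute)
  have PP_ne: "poly PP 0 \<noteq> 0"
  proof
    assume "poly PP 0 = 0"
    then have "poly LL 0 = 0" using LL0 q(1) t by simp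
    moreover have "poly LL (g t) = 0"
      using id1[of "g t"] Tg[OF tt] K_ne[OF tt] q(1) \<open>poly PP 0 = 0\<close> by auto
    ultimately have "poly LL x = 0" for x
      using LL_lin[of "g t"] LL_lin[of x] g_ne[OF tt] by simp
    then have "poly (pcompose RR Q * Tp t) x = 0" for x
      using id1[of x] \<open>poly PP 0 = 0\<close> by (simp add: poly_pcompose Q_def mult.commute)
    then have "pcompose RR Q * Tp t = 0"
      using poly_all_0_iff_0 by blast
    then have "pcompose RR Q = 0" using Tp_ne by simp
    then show False
      using RR_ne q(1) pcompose_eq_0[of RR Q] by (simp add: Q_def)
  qed
  define c where "c = poly LL 0"
  have c: "c \<noteq> 0" "poly PP 0 = t' * c"
    using PP_ne LL0 unfolding c_def t'_def by auto
  have t'_ne: "t' \<noteq> 0" using s_ne[OF tt'] .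
  have l1: "coeff LL 1 = - c * f t"
  proof -
    let ?K = "(t' - b6 * g t') * (b6 * t' - g t')"
    \<comment> \<open>At time \<open>t'\<close> the definition of \<open>f\<close> refers to
      \<open>f (t' / q)\<close>, which is \<open>f t\<close>.\<close>
    have "poly (Wp t') (g t') = - (1 / t') * ?K * (f t * g t' - 1)"
      unfolding f_def[OF tt'] using q(1) by (simp add: t'_def algebra_simps)
    then have "?K * (- c * (f t * g t' - 1)) = ?K * (c + coeff LL 1 * g t')"
      using id2[of "g t'"] Tg[OF tt'] t'_ne LL_lin[of "g t'"] unfolding c(2) c_def[symmetric]
      by (simp add: mult_ac)
    then have "- c * (f t * g t' - 1) = c + coeff LL 1 * g t'"
      using K_ne[OF tt'] by (metis mult_left_cancel)
    then have "(coeff LL 1 + c * f t) * g t' = 0" by (simp add: algebra_simps)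
    then show ?thesis using g_ne[OF tt'] by (simp add: add_eq_0_iff)
  qed

  \<comment> \<open>The determinant identity at \<open>g t\<close>\<close>
  define K where "K = (t - b6 * g t) * (b6 * t - g t)"
  have K: "K \<noteq> 0" unfolding K_def using K_ne[OF tt] .
  have "q * c * (t * poly (Wm t) (g t)) = q * c * (K * (1 - f t * g t))"
    using id1[of "g t"] Tg[OF tt] LL_lin[of "g t"] unfolding c(2) c_def[symmetric] l1 K_def t'_def
    by (simp add: algebra_simps)
  then have Wm_g: "t * poly (Wm t) (g t) = K * (1 - f t * g t)"
    using c(1) q(1) by simp
  have Wp_g: "t * poly (Wp t) (g t) = - K * (f (t / q) * g t - 1)"
  proof -
    have cancel: "t * (- (1 / t) * y * z * c) = - (y * z * c)" for y z c :: complex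
      using t by simp
    then show ?thesis
      unfolding f_def[OF tt] K_def cancel by (simp add: algebra_simps)
  qed
  \<comment> \<open>One \<open>K\<close> cancels against the same quadratic factor inside
    \<open>Dp * Dm\<close>; the other is \<open>b6\<close> times the denominator of the
    claim.\<close>
  have "K * (K * ((g t * f (t / q) - 1) * (g t * f t - 1))) =
      (t * poly (Wp t) (g t)) * (t * poly (Wm t) (g t))"
    unfolding Wm_g Wp_g by (simp add: algebra_simps)
  also have "\<dots> = t\<^sup>2 * (Dp t (g t) * Dm t (g t))"
    using det[of "g t"] Tg[OF tt] by (simp add: power2_eq_square mult_ac)
  also have "\<dots> = K * (t\<^sup>2 * b6 * ((1 - b1 * g t) * (1 - b2 * g t) * (1 - b3 * g t) * (1 - b4 * g t)))"
    unfolding Dp_def Dm_def D_plus_def D_minus_def K_def by (simp only: mult_ac)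
  finally have eq: "K * ((g t * f (t / q) - 1) * (g t * f t - 1)) =
      t\<^sup>2 * b6 * ((1 - b1 * g t) * (1 - b2 * g t) * (1 - b3 * g t) * (1 - b4 * g t))"
    using K by simp
  have prod: "(1 - b1 * g t) * (1 - b2 * g t) * (1 - b3 * g t) * (1 - b4 * g t) =
      (g t - 1 / b1) * (g t - 1 / b2) * (g t - 1 / b3) * (g t - 1 / b4)"
  proof -
    have lin: "1 - \<beta> * g t = - \<beta> * (g t - 1 / \<beta>)" if "\<beta> \<noteq> 0" for \<beta>
      using that by (simp add: algebra_simps)
    \<comment> \<open>The four signs cancel, and the product of the four extracted parameters is
      \<open>1\<close>.\<close>
    have "(1 - b1 * g t) * (1 - b2 * g t) * (1 - b3 * g t) * (1 - b4 * g t) =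
        b1 * b2 * b3 * b4 * ((g t - 1 / b1) * (g t - 1 / b2) * (g t - 1 / b3) * (g t - 1 / b4))"
      unfolding lin[OF b(1)] lin[OF b(2)] lin[OF b(3)] lin[OF b(4)] by (simp only: mult_ac mult_minus_left mult_minus_right minus_minus)
    then show ?thesis using b(6) by simp
  qed
  have K_eq: "K = b6 * ((g t - b6 * t) * (g t - t / b6))"
    unfolding K_def using b(5) by (simp add: algebra_simps)
  then have M: "(g t - b6 * t) * (g t - t / b6) \<noteq> 0"
    using K by auto
  show ?thesis
    using eq b(5) unfolding prod K_eq nonzero_eq_divide_eq[OF M] by (simp add: mult_ac)
qed

end
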